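(* Let $J=(a_0,+\infty)$ with $a_0\in\mathbb{R}\cup\{-\infty\}$, let $h\colon J\to(0,+\infty)$ be a growth rate with associated group $(J,\ast)$ and unit element $e_\ast=h^{-1}(1)$, and let $A\colon J\to M_n(\mathbb{R})$ be continuous. Suppose that the linear system $x'=A(t)x$, $t\in J$, has a uniform bounded $h$-growth on $[e_\ast,+\infty)$ and a uniform bounded $h$-decay on $(a_0,e_\ast]$. Then the following three statements are equivalent: (i) The system has uniform $h$-dichotomies on $[e_\ast,+\infty)$ and on $(a_0,e_\ast]$, and it has no nontrivial solution bounded on $J$. (ii) The system is $h$-expansive on $J$. (iii) The system is uniformly $h$-noncritical on $J$. Moreover, without the assumptions of uniform bounded $h$-growth and $h$-decay, the implications (i) $\Rightarrow$ (ii) $\Rightarrow$ (iii) still hold.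
   Context: Fix a norm $|\cdot|$ on $\mathbb{R}^n$ with induced matrix norm $\|\cdot\|$. $\Phi(t,s)$ denotes the transition matrix of $x'=A(t)x$ (so $\Phi(t,s)=\Phi(t)\Phi^{-1}(s)$ for any fundamental matrix $\Phi$). Growth rate: a strictly increasing homeomorphism $h\colon J=(a_0,+\infty)\to(0,+\infty)$. Group $(J,\ast)$: $t\ast s:=h^{-1}(h(t)h(s))$, with unit $e_\ast=h^{-1}(1)$ and inverse $t^{\ast-1}=h^{-1}(1/h(t))$. Absolute value: $|t|_\ast=t$ if $t\ge e_\ast$, and $|t|_\ast=t^{\ast-1}$ if $t<e_\ast$. Uniform $h$-dichotomy on an interval $\mathcal{I}\subseteq J$: there exist projectors $P(t)$ ($P(t)^2=P(t)$), $t\in\mathcal{I}$, and constants $K\ge1$, $\alpha>0$ such that $P(t)\Phi(t,s)=\Phi(t,s)P(s)$ for all $t,s\in\mathcal{I}$; $\|\Phi(t,s)P(s)\|\le K(h(t)/h(s))^{-\alpha}$ for all $t\ge s$ in $\mathcal{I}$; and $\|\Phi(t,s)(I-P(s))\|\le K(h(s)/h(t))^{-\alpha}$ for all $s\ge t$ in $\mathcal{I}$. (The projectors and constants of the dichotomies on the two half-intervals need not be the same.) Uniform bounded $h$-growth on $\mathcal{I}\subseteq J$: for each $T>e_\ast$ there exists $C_T\ge1$ such that every solution $x$ satisfies $|x(t)|\le C_T|x(s)|$ for all $s\in\mathcal{I}$ and $t\in[s,s\ast T]\cap\mathcal{I}$. Uniform bounded $h$-decay on $\mathcal{I}\subseteq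 J$: for each $T>e_\ast$ there exists $C_T\ge1$ such that every solution $x$ satisfies $|x(t)|\le C_T|x(s)|$ for all $s\in\mathcal{I}$ and $t\in[s\ast T^{\ast-1},s]\cap\mathcal{I}$. Uniformly $h$-noncritical on $\mathcal{I}\subseteq J$: there exist $T>e_\ast$ and $\theta\in(0,1)$ such that every solution $x$ satisfies $|x(t)|\le\theta\sup\{|x(u)|: |u\ast t^{\ast-1}|_\ast\le T\}$ (i.e. the supremum over $u\in[t\ast T^{\ast-1},t\ast T]$) for all $t$ with $[t\ast T^{\ast-1},t\ast T]\subset\mathcal{I}$. For $\mathcal{I}=J$ this is required for all $t\in J$. $h$-expansive on $\mathcal{I}\subseteq J$: there exist constants $L,\beta>0$ such that for every solution $x$, every $[a,b]\subset\mathcal{I}$ and every $t\in[a,b]$, $|x(t)|\le L\{h(t\ast a^{\ast-1})^{-\beta}|x(a)|+h(b\ast t^{\ast-1})^{-\beta}|x(b)|\}$. *)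

theory Defs
  imports "HOL-Analysis.Analysis"
begin

definition is_norm :: "(real^'n \<Rightarrow> real) \<Rightarrow> bool" where
  "is_norm N \<longleftrightarrow>
     (\<forall>x. 0 \<le> N x) \<and> (\<forall>x. N x = 0 \<longleftrightarrow> x = 0) \<and>
     (\<forall>c x. N (c *\<^sub>R x) = \<bar>c\<bar> * N x) \<and> (\<forall>x y. N (x + y) \<le> N x + N y)"

definition matrix_norm :: "(real^'n \<Rightarrow> real) \<Rightarrow> real^'n^'n \<Rightarrow> real" where
  "matrix_norm N M = (SUP x\<in>{x. N x = 1}. N (M *v x))"

definition growth_rate :: "real set \<Rightarrow> (real \<Rightarrow> real) \<Rightarrow> bool" where
  "growth_rate J h \<longleftrightarrow> strict_mono_on J h \<and> (\<exists>g. homeomorphism J {0<..} h g)"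

(* The operations below are meaningful for arguments in J, where inv_into J h is the inverse
   of the growth rate h. *)

definition gmult :: "real set \<Rightarrow> (real \<Rightarrow> real) \<Rightarrow> real \<Rightarrow> real \<Rightarrow> real" where
  "gmult J h t s = inv_into J h (h t * h s)"

definition gunit :: "real set \<Rightarrow> (real \<Rightarrow> real) \<Rightarrow> real" where
  "gunit J h = inv_into J h 1"

definition ginv :: "real set \<Rightarrow> (real \<Rightarrow> real) \<Rightarrow> real \<Rightarrow> real" where
  "ginv J h t = inv_into J h (1 / h t)"

definition gabs :: "real set \<Rightarrow> (real \<Rightarrow> real) \<Rightarrow> real \<Rightarrow> real" where
  "gabs J h t = (if gunit J h \<le> t then t else ginv J h t)"

definition is_solution ::
    "real set \<Rightarrow> (real \<Rightarrow> real^'n^'n) \<Rightarrow> (real \<Rightarrow> real^'n) \<Rightarrow> bool" where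
  "is_solution J A x \<longleftrightarrow>
     (\<forall>t\<in>J. (x has_vector_derivative A t *v x t) (at t within J))"

definition fundamental_matrix ::
    "real set \<Rightarrow> (real \<Rightarrow> real^'n^'n) \<Rightarrow> (real \<Rightarrow> real^'n^'n) \<Rightarrow> bool" where
  "fundamental_matrix J A F \<longleftrightarrow>
     (\<forall>t\<in>J. (F has_vector_derivative A t ** F t) (at t within J) \<and> invertible (F t))"

(* The choice of the fundamental matrix is immaterial: any two of them differ by a constant
   invertible right factor. *)
definition transition_matrix ::
    "real set \<Rightarrow> (real \<Rightarrow> real^'n^'n) \<Rightarrow> real \<Rightarrow> real \<Rightarrow> real^'n^'n" where
  "transition_matrix J A t s =
     (let F = (SOME F. fundamental_matrix J A F) in F t ** matrix_inv (F s))"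

definition has_nontrivial_bounded_solution ::
    "(real^'n \<Rightarrow> real) \<Rightarrow> real set \<Rightarrow> (real \<Rightarrow> real^'n^'n) \<Rightarrow> bool" where
  "has_nontrivial_bounded_solution N J A \<longleftrightarrow>
     (\<exists>x. is_solution J A x \<and> (\<exists>t\<in>J. x t \<noteq> 0) \<and> (\<exists>B. \<forall>t\<in>J. N (x t) \<le> B))"

(* Throughout, J is the domain of the growth rate h and of the system, so that solutions are
   defined on J, while I is the subinterval of J on which the property is asserted. *)

definition uniform_dichotomy ::
    "(real^'n \<Rightarrow> real) \<Rightarrow> real set \<Rightarrow> (real \<Rightarrow> real) \<Rightarrow> (real \<Rightarrow> real^'n^'n) \<Rightarrow> real set \<Rightarrow> bool"
  where
  "uniform_dichotomy N J h A I \<longleftrightarrow>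
     (\<exists>P K \<alpha>. 1 \<le> K \<and> 0 < \<alpha> \<and>
        (\<forall>t\<in>I. P t ** P t = P t) \<and>
        (\<forall>t\<in>I. \<forall>s\<in>I. P t ** transition_matrix J A t s = transition_matrix J A t s ** P s) \<and>
        (\<forall>t\<in>I. \<forall>s\<in>I. s \<le> t \<longrightarrow>
           matrix_norm N (transition_matrix J A t s ** P s) \<le> K * (h t / h s) powr (-\<alpha>)) \<and>
        (\<forall>t\<in>I. \<forall>s\<in>I. t \<le> s \<longrightarrow>
           matrix_norm N (transition_matrix J A t s ** (mat 1 - P s))
             \<le> K * (h s / h t) powr (-\<alpha>)))"

definition uniform_bounded_growth ::
    "(real^'n \<Rightarrow> real) \<Rightarrow> real set \<Rightarrow> (real \<Rightarrow> real) \<Rightarrow> (real \<Rightarrow> real^'n^'n) \<Rightarrow> real set \<Rightarrow> bool"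
  where
  "uniform_bounded_growth N J h A I \<longleftrightarrow>
     (\<forall>T>gunit J h. \<exists>C\<ge>1. \<forall>x. is_solution J A x \<longrightarrow>
        (\<forall>s\<in>I. \<forall>t\<in>{s..gmult J h s T} \<inter> I. N (x t) \<le> C * N (x s)))"

definition uniform_bounded_decay ::
    "(real^'n \<Rightarrow> real) \<Rightarrow> real set \<Rightarrow> (real \<Rightarrow> real) \<Rightarrow> (real \<Rightarrow> real^'n^'n) \<Rightarrow> real set \<Rightarrow> bool"
  where
  "uniform_bounded_decay N J h A I \<longleftrightarrow>
     (\<forall>T>gunit J h. \<exists>C\<ge>1. \<forall>x. is_solution J A x \<longrightarrow>
        (\<forall>s\<in>I. \<forall>t\<in>{gmult J h s (ginv J h T)..s} \<inter> I. N (x t) \<le> C * N (x s)))"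

definition uniformly_noncritical ::
    "(real^'n \<Rightarrow> real) \<Rightarrow> real set \<Rightarrow> (real \<Rightarrow> real) \<Rightarrow> (real \<Rightarrow> real^'n^'n) \<Rightarrow> real set \<Rightarrow> bool"
  where
  "uniformly_noncritical N J h A I \<longleftrightarrow>
     (\<exists>T \<theta>. gunit J h < T \<and> 0 < \<theta> \<and> \<theta> < 1 \<and>
        (\<forall>x. is_solution J A x \<longrightarrow>
          (\<forall>t\<in>J. {gmult J h t (ginv J h T)..gmult J h t T} \<subseteq> I \<longrightarrow>
             N (x t) \<le>
               \<theta> * (SUP u\<in>{u\<in>J. gabs J h (gmult J h u (ginv J h t)) \<le> T}. N (x u)))))"

definition expansive ::
    "(real^'n \<Rightarrow> real) \<Rightarrow> real set \<Rightarrow> (real \<Rightarrow> real) \<Rightarrow> (real \<Rightarrow> real^'n^'n) \<Rightarrow> real set \<Rightarrow> bool"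
  where
  "expansive N J h A I \<longleftrightarrow>
     (\<exists>L \<beta>. 0 < L \<and> 0 < \<beta> \<and>
        (\<forall>x. is_solution J A x \<longrightarrow>
          (\<forall>a b. {a..b} \<subseteq> I \<longrightarrow> (\<forall>t\<in>{a..b}.
             N (x t) \<le> L * (h (gmult J h t (ginv J h a)) powr (-\<beta>) * N (x a)
                          + h (gmult J h b (ginv J h t)) powr (-\<beta>) * N (x b))))))"

end

(* Write phi(tau) = h^(-1)(e^tau), an isomorphism from R onto the group J, and y(tau) v = F(phi(tau)) v for a
   fundamental matrix F. In terms of the linear flow y on R the three properties become exponential
   ones, so no differentiability of h is needed.

   (i) => (ii): a vector whose component growing at +infinity and whose component growing at -infinity both
   vanish gives a bounded solution, hence y(0) v is controlled by these two components, which are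
   estimated from b and from a. (ii) => (iii): take a = t - T and b = t + T with T large. (iii) => (i):
   with bounded growth, noncriticality yields the maximum principle that |y| on [a,b] is at most a
   constant times its maximum at the endpoints, for 0 <= a. Solutions bounded on the half-line
   therefore decay geometrically, and by compactness all solutions in a complement of these grow
   geometrically; bounded growth also bounds the angle between the two subspaces. The other half-line
   follows by reflection. *)
theory Submission
  imports Defs
begin

section \<open>Linear differential equations\<close>

text \<open>\<open>transition_matrix\<close> rests on a choice among fundamental matrices and says
  nothing until one is known to exist, so global solvability on \<open>J\<close> comes first.
  Invariance makes F(t)^(-1) P(t) F(t) independent of t, so a dichotomy is one constant splitting of
  the space of initial vectors. On a half-line its stable part is forced, being the set of vectors
  with bounded orbits, while the complement is free. The obstacle in (iii) => (i) is direction: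
  noncriticality yields a larger value near t without telling on which side, and bounded growth
  controls a solution only forwards in time. The maximum principle leaves two endpoints, and one of
  them must be eliminated. For a bounded orbit the right endpoint moves to infinity, where iterated
  noncriticality makes its contribution vanish. For a vector of the complement the left endpoint is
  dominated by the right one. Each elimination costs a constant, which a high enough power of
  \<theta> absorbs.\<close>

lemma bounded_bilinear_matrix_matrix_mult:
  "bounded_bilinear ((**) :: real^'n^'m \<Rightarrow> real^'p^'n \<Rightarrow> real^'p^'m)"
  unfolding bilinear_conv_bounded_bilinear [symmetric] bilinear_def
  by (auto intro!: linearI simp: vec_eq_iff matrix_matrix_mult_def sum.distrib sum_distrib_left
      algebra_simps)

lemma bounded_bilinear_matrix_vector_mult:
  "bounded_bilinear ((*v) :: real^'n^'m \<Rightarrow> real^'n \<Rightarrow> real^'m)"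
  unfolding bilinear_conv_bounded_bilinear [symmetric] bilinear_def
  by (auto intro!: linearI simp: vec_eq_iff matrix_vector_mult_def sum.distrib sum_distrib_left
      algebra_simps)

text \<open>Puts the adjoint equation G' = - G A into the form G' = prod A G, so that one existence
  theorem covers both it and the original system.\<close>

lemma bounded_bilinear_minus_flip:
  assumes "bounded_bilinear f"
  shows "bounded_bilinear (\<lambda>x y. - f y x)"
proof -
  interpret f: bounded_bilinear f by fact
  obtain K where "\<And>x y. norm (f x y) \<le> norm x * norm y * K" using f.bounded by blast
  then have "\<And>x y. norm (f y x) \<le> norm x * norm y * K" by (metis mult.commute)
  then show ?thesis
    by unfold_locales (auto simp: f.add_left f.add_right f.scaleR_left f.scaleR_right
        intro!: exI[of _ K])
qed

section \<open>Global solvability by Picard series\<close>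

text \<open>The induction step of the Picard estimate: integrating a power bound raises the exponent
  by one and divides by it, which builds up the factorial. Running along the segment from
  \<open>t0\<close> to \<open>t\<close> with a parameter in [0,1] treats both orders of
  \<open>t0\<close> and \<open>t\<close> at once.\<close>

lemma norm_le_of_derivative_power_bound:
  fixes g :: "real \<Rightarrow> 'a::euclidean_space"
  assumes der: "\<And>s. s \<in> closed_segment t0 t \<Longrightarrow> (g has_vector_derivative g' s) (at s)"
    and bnd: "\<And>s. s \<in> closed_segment t0 t \<Longrightarrow> norm (g' s) \<le> B * \<bar>s - t0\<bar> ^ k"
    and zero: "g t0 = 0"
  shows "norm (g t) \<le> B * \<bar>t - t0\<bar> ^ Suc k / Suc k"
proof -
  define w where "w r = t0 + r * (t - t0)" for r
  have w: "w r \<in> closed_segment t0 t" if "0 \<le> r" "r \<le> 1" for r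
    using that unfolding w_def closed_segment_def by (auto intro!: exI[of _ r] simp: algebra_simps)
  have wd: "(w has_vector_derivative (t - t0)) (at r)" for r
    unfolding w_def by (auto intro!: derivative_eq_intros)
  have gd: "((\<lambda>r. g (w r)) has_vector_derivative ((t - t0) *\<^sub>R g' (w r))) (at r)"
    if "0 \<le> r" "r \<le> 1" for r
    using vector_diff_chain_at[OF wd[of r] der[OF w[OF that]]] by (simp add: o_def)
  define \<phi> where "\<phi> r = B * \<bar>t - t0\<bar> ^ Suc k * r ^ Suc k / Suc k" for r
  have "norm (g (w 1) - g (w 0)) \<le> \<phi> 1 - \<phi> 0"
  proof (rule differentiable_bound_general)
    show "continuous_on {0..1} (\<lambda>r. g (w r))"
      by (intro continuous_at_imp_continuous_on ballI has_vector_derivative_continuous[OF gd]) auto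
    show "continuous_on {0..1} \<phi>"
      unfolding \<phi>_def by (intro continuous_intros) auto
    show "(\<phi> has_vector_derivative B * \<bar>t - t0\<bar> ^ Suc k * r ^ k) (at r)" for r
      unfolding \<phi>_def has_real_derivative_iff_has_vector_derivative [symmetric]
      by (auto intro!: derivative_eq_intros simp del: power_Suc of_nat_Suc)
    show "((\<lambda>r. g (w r)) has_vector_derivative ((t - t0) *\<^sub>R g' (w r))) (at r)"
      if "0 < r" "r < 1" for r
      using that by (intro gd) auto
    show "norm ((t - t0) *\<^sub>R g' (w r)) \<le> B * \<bar>t - t0\<bar> ^ Suc k * r ^ k" if "0 < r" "r < 1" for r
    proof -
      have "norm (g' (w r)) \<le> B * \<bar>w r - t0\<bar> ^ k"
        using that by (intro bnd w) auto
      also have "\<bar>w r - t0\<bar> = r * \<bar>t - t0\<bar>"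
        using that by (simp add: w_def abs_mult)
      finally have "\<bar>t - t0\<bar> * norm (g' (w r)) \<le> \<bar>t - t0\<bar> * (B * (r * \<bar>t - t0\<bar>) ^ k)"
        by (rule mult_left_mono) simp
      then show ?thesis by (simp add: power_mult_distrib mult_ac)
    qed
  qed auto
  then show ?thesis
    by (simp add: w_def \<phi>_def zero)
qed

text \<open>Picard iteration; the increments are bounded by \<open>C (B \<bar>t - t\<^sub>0\<bar>)\<^sup>k / k!\<close>
  on compact intervals, so the series converges together with its derivatives.\<close>

theorem linear_ode_solution_exists:
  fixes prod :: "'b::real_normed_vector \<Rightarrow> 'a::euclidean_space \<Rightarrow> 'a"
  assumes bil: "bounded_bilinear prod"
    and cont: "continuous_on (einterval a b) A"
    and t0: "t0 \<in> einterval a b"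
  obtains x where "x t0 = x0"
    "\<And>t. t \<in> einterval a b \<Longrightarrow> (x has_vector_derivative prod (A t) (x t)) (at t)"
proof -
  interpret bounded_bilinear prod by (rule bil)
  let ?J = "einterval a b"
  have "open ?J" by simp
  have ab: "a < b" using t0 by (auto simp: einterval_def)
  \<comment> \<open>Antiderivatives on the whole open interval replace integrals from
    \<open>t0\<close>, so every iterate is global and no continuation argument arises.\<close>
  have anti: "\<exists>F. F t0 = 0 \<and> (\<forall>t\<in>?J. (F has_vector_derivative f t) (at t))"
    if "continuous_on ?J f" for f :: "real \<Rightarrow> 'a"
  proof -
    have "\<And>t. a < ereal t \<Longrightarrow> ereal t < b \<Longrightarrow> isCont f t"
      using that \<open>open ?J\<close> by (metis (no_types) continuous_on_eq_continuous_at einterval_iff)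
    from einterval_antiderivative[OF ab this] obtain F
      where F: "\<forall>t. a < ereal t \<longrightarrow> ereal t < b \<longrightarrow> (F has_vector_derivative f t) (at t)"
      by blast
    have "((\<lambda>t. F t - F t0) has_vector_derivative f t) (at t)" if "t \<in> ?J" for t
      using F that by (auto intro!: derivative_eq_intros simp: einterval_def)
    then show ?thesis by (intro exI[of _ "\<lambda>t. F t - F t0"]) auto
  qed
  define I where "I f = (SOME F. F t0 = 0 \<and> (\<forall>t\<in>?J. (F has_vector_derivative f t) (at t)))"
    for f :: "real \<Rightarrow> 'a"
  have I: "I f t0 = 0 \<and> (\<forall>t\<in>?J. (I f has_vector_derivative f t) (at t))"
    if "continuous_on ?J f" for f
    unfolding I_def using someI_ex[OF anti[OF that]] .
  \<comment> \<open>By linearity the increments of the Picard iteration obey the recursion of the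
    iterates themselves; \<open>m k\<close> is the k-th increment and the solution is their
    sum.\<close>
  define m where "m = rec_nat (\<lambda>_. x0) (\<lambda>_ f. I (\<lambda>t. prod (A t) (f t)))"
  have m0: "m 0 = (\<lambda>_. x0)" and mS: "m (Suc k) = I (\<lambda>t. prod (A t) (m k t))" for k
    by (simp_all add: m_def)
  have mcont: "continuous_on ?J (m k)" for k
  proof (induction k)
    case (Suc k)
    have "continuous_on ?J (\<lambda>t. prod (A t) (m k t))"
      by (rule continuous_on[OF cont Suc])
    then show ?case
      unfolding mS using I has_vector_derivative_continuous
      by (metis continuous_at_imp_continuous_on)
  qed (simp add: m0)
  have pcont: "continuous_on ?J (\<lambda>t. prod (A t) (m k t))" for k
    by (rule continuous_on[OF cont mcont])
  have mz: "m (Suc k) t0 = 0" for k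
    unfolding mS using I[OF pcont] by blast
  have md: "(m (Suc k) has_vector_derivative prod (A t) (m k t)) (at t)" if "t \<in> ?J" for t k
    unfolding mS using I[OF pcont] that by blast
  define x where "x t = (\<Sum>k. m k t)" for t
  have x0: "x t0 = x0"
  proof -
    have "(\<lambda>k. m k t0) sums (\<Sum>k\<in>{0}. m k t0)"
      by (rule sums_finite) (use mz gr0_implies_Suc in \<open>auto\<close>)
    then show ?thesis
      using sums_unique by (force simp: x_def m0)
  qed
  have "(x has_vector_derivative prod (A t) (x t)) (at t)" if "t \<in> ?J" for t
  proof -
    \<comment> \<open>A compact interval inside the domain with both \<open>t\<close> and
      \<open>t0\<close> in its interior: compactness bounds \<open>A\<close>, and at the interior
      point \<open>t\<close> the one-sided derivative notion is the full one.\<close>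
    have "min t t0 \<in> ?J" "max t t0 \<in> ?J" using that t0 by (auto simp: min_def max_def)
    then obtain e1 e2 where e: "e1 > 0" "cball (min t t0) e1 \<subseteq> ?J" "e2 > 0" "cball (max t t0) e2 \<subseteq> ?J"
      using \<open>open ?J\<close> open_contains_cball by metis
    define c d where "c = min t t0 - e1" and "d = max t t0 + e2"
    have "c \<in> ?J" "d \<in> ?J" using e by (auto simp: c_def d_def subset_iff dist_real_def)
    have cd: "c < t" "c < t0" "t < d" "t0 < d" using e by (auto simp: c_def d_def)
    define S where "S = {c..d}"
    have SJ: "S \<subseteq> ?J"
    proof
      fix u assume "u \<in> S"
      then have "ereal c \<le> ereal u" "ereal u \<le> ereal d" by (auto simp: S_def)
      then show "u \<in> ?J" using \<open>c \<in> ?J\<close> \<open>d \<in> ?J\<close>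
        unfolding einterval_iff by (meson less_le_trans le_less_trans)
    qed
    have "compact (A ` S)"
      unfolding S_def by (intro compact_continuous_image continuous_on_subset[OF cont] SJ[unfolded S_def]) simp
    then obtain M where M: "\<And>s. s \<in> S \<Longrightarrow> norm (A s) \<le> M"
      by (meson bounded_iff compact_imp_bounded imageI)
    obtain K where K: "K > 0" "\<And>u v. norm (prod u v) \<le> norm u * norm v * K"
      using pos_bounded by blast
    define B where "B = M * K"
    have "t \<in> S" using cd by (auto simp: S_def)
    then have "0 \<le> M" using order_trans[OF norm_ge_zero M] by blast
    then have "B \<ge> 0" using K by (simp add: B_def)
    have AB: "norm (prod (A s) v) \<le> B * norm v" if "s \<in> S" for s v
    proof -
      have "norm (prod (A s) v) \<le> norm (A s) * (norm v * K)" using K by (simp add: mult.assoc)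
      also have "\<dots> \<le> M * (norm v * K)" using M[OF that] K by (intro mult_right_mono) auto
      finally show ?thesis by (simp add: B_def ac_simps)
    qed
    have mb: "norm (m k s) \<le> norm x0 * B ^ k / fact k * \<bar>s - t0\<bar> ^ k" if "s \<in> S" for k s
      using that
    proof (induction k arbitrary: s)
      case (Suc k)
      have seg: "closed_segment t0 s \<subseteq> S"
        unfolding S_def using Suc.prems cd by (auto simp: S_def closed_segment_eq_real_ivl)
      have "norm (m (Suc k) s) \<le> B * (norm x0 * B ^ k / fact k) * \<bar>s - t0\<bar> ^ Suc k / Suc k"
      proof (rule norm_le_of_derivative_power_bound)
        fix u assume "u \<in> closed_segment t0 s"
        then have u: "u \<in> S" using seg by auto
        then show "(m (Suc k) has_vector_derivative prod (A u) (m k u)) (at u)"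
          using SJ md by auto
        have "norm (prod (A u) (m k u)) \<le> B * norm (m k u)" by (rule AB[OF u])
        also have "\<dots> \<le> B * (norm x0 * B ^ k / fact k * \<bar>u - t0\<bar> ^ k)"
          by (rule mult_left_mono[OF Suc.IH[OF u] \<open>B \<ge> 0\<close>])
        finally show "norm (prod (A u) (m k u)) \<le> B * (norm x0 * B ^ k / fact k) * \<bar>u - t0\<bar> ^ k"
          by (simp add: mult.assoc)
      qed (rule mz)
      then show ?case by (simp add: field_simps)
    qed (simp add: m0)
    define R where "R = d - c"
    have mb': "norm (m k s) \<le> norm x0 * (inverse (fact k) * (B * R) ^ k)" if "s \<in> S" for k s
    proof -
      have "\<bar>s - t0\<bar> \<le> R" using that cd by (auto simp: S_def R_def)
      then have "norm x0 * B ^ k / fact k * \<bar>s - t0\<bar> ^ k \<le> norm x0 * B ^ k / fact k * R ^ k"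
        using \<open>B \<ge> 0\<close> by (intro mult_left_mono power_mono) auto
      then show ?thesis using mb[OF that, of k] by (simp add: field_simps power_mult_distrib)
    qed
    have "summable (\<lambda>k. norm x0 * (inverse (fact k) * (B * R) ^ k))"
      by (intro summable_mult summable_exp)
    then have unif: "uniform_limit S (\<lambda>n s. \<Sum>k<n. m k s) x sequentially"
      unfolding x_def using mb' by (intro Weierstrass_m_test)
    define p where "p n s = (\<Sum>k<n. m k s)" for n s
    \<comment> \<open>The derivative lags one index behind; the lag disappears in the limit, as
      \<open>p n\<close> converges uniformly to \<open>x\<close>.\<close>
    have pd: "(p (Suc n) has_vector_derivative prod (A s) (p n s)) (at s)" if "s \<in> S" for n s
    proof (induction n)
      case 0
      then show ?case by (simp add: p_def m0 zero_right fun_eq_iff[symmetric])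
    next
      case (Suc n)
      have "((\<lambda>s. p (Suc n) s + m (Suc n) s) has_vector_derivative
          prod (A s) (p n s) + prod (A s) (m n s)) (at s)"
        using Suc md SJ that by (intro has_vector_derivative_add) auto
      then show ?case by (simp add: p_def add_right[symmetric] add.commute add.left_commute)
    qed
    have lim: "(\<lambda>n. p (Suc n) s) \<longlonglongrightarrow> x s" if "s \<in> S" for s
      using tendsto_uniform_limitI[OF unif that] unfolding p_def by (rule LIMSEQ_Suc)
    have "\<exists>g. \<forall>s\<in>S. (\<lambda>n. p (Suc n) s) \<longlonglongrightarrow> g s \<and>
        (g has_derivative (\<lambda>r. r *\<^sub>R prod (A s) (x s))) (at s within S)"
    proof (rule has_derivative_sequence)
      show "convex S" "t0 \<in> S" using cd by (auto simp: S_def)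
      show "(p (Suc n) has_derivative (\<lambda>r. r *\<^sub>R prod (A s) (p n s))) (at s within S)"
        if "s \<in> S" for n s
        using pd[OF that] has_vector_derivative_at_within unfolding has_vector_derivative_def by blast
      show "(\<lambda>n. p (Suc n) t0) \<longlonglongrightarrow> x t0" using cd by (intro lim) (auto simp: S_def)
      fix \<epsilon> :: real assume "\<epsilon> > 0"
      \<comment> \<open>Dividing by \<open>B + 1\<close> covers the case
        \<open>B = 0\<close>.\<close>
      then have "\<forall>\<^sub>F n in sequentially. \<forall>s\<in>S. dist (p n s) (x s) < \<epsilon> / (B + 1)"
        using unif \<open>B \<ge> 0\<close> unfolding uniform_limit_iff p_def by simp
      then show "\<forall>\<^sub>F n in sequentially. \<forall>s\<in>S. \<forall>r.
          norm (r *\<^sub>R prod (A s) (p n s) - r *\<^sub>R prod (A s) (x s)) \<le> \<epsilon> * norm r"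
      proof eventually_elim
        case (elim n)
        show ?case
        proof (intro ballI allI)
          fix s r assume "s \<in> S"
          have "norm (prod (A s) (p n s - x s)) \<le> B * norm (p n s - x s)"
            by (rule AB[OF \<open>s \<in> S\<close>])
          also have "\<dots> \<le> (B + 1) * (\<epsilon> / (B + 1))"
            using elim \<open>s \<in> S\<close> \<open>B \<ge> 0\<close> \<open>\<epsilon> > 0\<close>
            by (intro mult_mono) (auto simp: dist_norm intro: less_imp_le)
          also have "\<dots> = \<epsilon>" using \<open>B \<ge> 0\<close> by simp
          finally have "\<bar>r\<bar> * norm (prod (A s) (p n s - x s)) \<le> \<bar>r\<bar> * \<epsilon>"
            by (intro mult_left_mono) auto
          then show "norm (r *\<^sub>R prod (A s) (p n s) - r *\<^sub>R prod (A s) (x s)) \<le> \<epsilon> * norm r"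
            by (simp add: diff_right scaleR_diff_right[symmetric] mult.commute)
        qed
      qed
    qed
    then obtain g where g: "\<And>s. s \<in> S \<Longrightarrow> (\<lambda>n. p (Suc n) s) \<longlonglongrightarrow> g s"
        "\<And>s. s \<in> S \<Longrightarrow> (g has_vector_derivative prod (A s) (x s)) (at s within S)"
      unfolding has_vector_derivative_def by blast
    have gx: "g s = x s" if "s \<in> S" for s
      using g(1)[OF that] lim[OF that] LIMSEQ_unique by blast
    have "(x has_vector_derivative prod (A t) (x t)) (at t within S)"
      by (rule has_vector_derivative_transform[OF \<open>t \<in> S\<close> _ g(2)[OF \<open>t \<in> S\<close>]]) (simp add: gx)
    then show ?thesis
      using at_within_interior[of t S] cd by (simp add: S_def)
  qed
  with x0 show thesis by (rule that)
qed

section \<open>Fundamental matrices and the solution space\<close>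

text \<open>A solution \<open>G\<close> of the adjoint equation makes \<open>G t ** Y t\<close>
  constant for every matrix solution and \<open>G t *v x t\<close> constant for every vector
  solution. The former exhibits \<open>G\<close> as the inverse of \<open>X\<close>, the latter
  gives uniqueness without a Gronwall estimate.\<close>

lemma solution_structure:
  fixes A :: "real \<Rightarrow> real^'n^'n"
  assumes J: "J = einterval a b" "J \<noteq> {}" and A: "continuous_on J A"
  obtains F where "fundamental_matrix J A F" "transition_matrix J A = (\<lambda>t s. F t ** matrix_inv (F s))"
    "continuous_on J F" "\<And>x. is_solution J A x \<longleftrightarrow> (\<exists>v. \<forall>t\<in>J. x t = F t *v v)"
proof -
  note bmm = bounded_bilinear_matrix_matrix_mult and bmv = bounded_bilinear_matrix_vector_mult
  have "open J" using J by simp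
  have cvx: "convex J"
    unfolding J(1) is_interval_convex_1[symmetric]
    by (simp add: is_interval_1 Ball_def einterval_iff) (meson ereal_less_eq(3) less_le_trans le_less_trans)
  obtain t0 where t0: "t0 \<in> J" using J(2) by blast
  obtain X where X0: "X t0 = mat 1" and X: "\<And>t. t \<in> J \<Longrightarrow> (X has_vector_derivative A t ** X t) (at t)"
    using linear_ode_solution_exists[OF bmm A[unfolded J(1)] t0[unfolded J(1)]] unfolding J(1) by metis
  obtain G where G0: "G t0 = mat 1"
    and G: "\<And>t. t \<in> J \<Longrightarrow> (G has_vector_derivative - (G t ** A t)) (at t)"
    using linear_ode_solution_exists[OF bounded_bilinear_minus_flip[OF bmm] A[unfolded J(1)] t0[unfolded J(1)]]
    unfolding J(1) by metis
  have const_mat: "\<exists>c. \<forall>t\<in>J. G t ** Y t = c"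
    if "\<And>t. t \<in> J \<Longrightarrow> (Y has_vector_derivative A t ** Y t) (at t within J)" for Y :: "real \<Rightarrow> real^'n^'n"
  proof -
    have "((\<lambda>t. G t ** Y t) has_vector_derivative 0) (at t within J)" if "t \<in> J" for t
    proof -
      have "((\<lambda>t. G t ** Y t) has_vector_derivative G t ** (A t ** Y t) + (- (G t ** A t)) ** Y t) (at t within J)"
        using that by (intro bounded_bilinear.has_vector_derivative[OF bmm] has_vector_derivative_at_within[OF G]
            \<open>\<And>t. t \<in> J \<Longrightarrow> (Y has_vector_derivative A t ** Y t) (at t within J)\<close>)
      moreover have "G t ** (A t ** Y t) + (- (G t ** A t)) ** Y t = 0"
        by (simp add: matrix_mul_assoc bounded_bilinear.minus_left[OF bmm])
      ultimately show ?thesis by simp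
    qed
    then show ?thesis by (rule has_vector_derivative_zero_constant[OF cvx]) blast+
  qed
  have const_vec: "\<exists>c. \<forall>t\<in>J. G t *v x t = c" if "is_solution J A x" for x
  proof -
    have "((\<lambda>t. G t *v x t) has_vector_derivative 0) (at t within J)" if "t \<in> J" for t
    proof -
      have "((\<lambda>t. G t *v x t) has_vector_derivative G t *v (A t *v x t) + (- (G t ** A t)) *v x t) (at t within J)"
        using that \<open>is_solution J A x\<close> unfolding is_solution_def
        by (intro bounded_bilinear.has_vector_derivative[OF bmv] has_vector_derivative_at_within[OF G]) auto
      moreover have "G t *v (A t *v x t) + (- (G t ** A t)) *v x t = 0"
        by (simp add: matrix_vector_mul_assoc bounded_bilinear.minus_left[OF bmv])
      ultimately show ?thesis by simp
    qed
    then show ?thesis by (rule has_vector_derivative_zero_constant[OF cvx]) blast+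
  qed
  have GX: "G t ** X t = mat 1" if "t \<in> J" for t
    using const_mat[of X] has_vector_derivative_at_within[OF X] t0 X0 G0 that
    by (metis matrix_mul_lid)
  then have XG: "X t ** G t = mat 1" if "t \<in> J" for t
    using that matrix_left_right_inverse by blast
  have "fundamental_matrix J A X"
    unfolding fundamental_matrix_def invertible_def
    using X GX XG has_vector_derivative_at_within by blast
  \<comment> \<open>This is the very choice made inside \<open>transition_matrix\<close>; it differs
    from \<open>X\<close> by the constant invertible right factor \<open>c\<close>.\<close>
  define F where "F = (SOME F. fundamental_matrix J A F)"
  have F: "fundamental_matrix J A F"
    unfolding F_def using someI[of "fundamental_matrix J A", OF \<open>fundamental_matrix J A X\<close>] .
  have Fd: "(F has_vector_derivative A t ** F t) (at t within J)" and Finv: "invertible (F t)" if "t \<in> J" for t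
    using F that unfolding fundamental_matrix_def by auto
  obtain c where c: "\<And>t. t \<in> J \<Longrightarrow> G t ** F t = c" using const_mat[OF Fd] by blast
  have "invertible (G t0)" using GX XG t0 unfolding invertible_def by blast
  then have "invertible c" using c[OF t0] Finv[OF t0] invertible_mult by blast
  then obtain c' where c': "c ** c' = mat 1" unfolding invertible_def by blast
  have FX: "F t = X t ** c" if "t \<in> J" for t
    using c[OF that] XG[OF that] by (metis matrix_mul_assoc matrix_mul_lid)
  have sol: "is_solution J A x \<longleftrightarrow> (\<exists>v. \<forall>t\<in>J. x t = F t *v v)" for x
  proof
    assume "is_solution J A x"
    then obtain w where w: "\<And>t. t \<in> J \<Longrightarrow> G t *v x t = w" using const_vec by blast
    have "x t = F t *v (c' *v w)" if "t \<in> J" for t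
    proof -
      have "F t *v (c' *v w) = (X t ** (c ** c')) *v w"
        by (simp add: FX[OF that] matrix_vector_mul_assoc matrix_mul_assoc)
      also have "\<dots> = (X t ** G t) *v x t"
        by (simp add: c' matrix_vector_mul_assoc[symmetric] w[OF that])
      finally show ?thesis by (simp add: XG[OF that])
    qed
    then show "\<exists>v. \<forall>t\<in>J. x t = F t *v v" by blast
  next
    assume "\<exists>v. \<forall>t\<in>J. x t = F t *v v"
    then obtain v where v: "\<And>t. t \<in> J \<Longrightarrow> x t = F t *v v" by blast
    show "is_solution J A x"
      unfolding is_solution_def
    proof
      fix t assume t: "t \<in> J"
      have "((\<lambda>t. F t *v v) has_vector_derivative F t *v 0 + (A t ** F t) *v v) (at t within J)"
        by (intro bounded_bilinear.has_vector_derivative[OF bmv] Fd[OF t] has_vector_derivative_const)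
      then have "((\<lambda>t. F t *v v) has_vector_derivative A t *v x t) (at t within J)"
        by (simp add: v[OF t] matrix_vector_mul_assoc)
      then show "(x has_vector_derivative A t *v x t) (at t within J)"
        by (rule has_vector_derivative_transform[OF t, rotated]) (rule v)
    qed
  qed
  have "continuous_on J F"
    unfolding continuous_on_eq_continuous_within using Fd has_vector_derivative_continuous by blast
  moreover have "transition_matrix J A = (\<lambda>t s. F t ** matrix_inv (F s))"
    by (intro ext) (simp add: transition_matrix_def F_def[symmetric] Let_def)
  ultimately show thesis using F sol that by blast
qed


section \<open>Norms\<close>

context
  fixes N :: "real^'n \<Rightarrow> real"
  assumes N: "is_norm N"
begin

lemma is_norm_nonneg: "0 \<le> N x"
  and is_norm_eq_0: "N x = 0 \<longleftrightarrow> x = 0"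
  and is_norm_scaleR: "N (c *\<^sub>R x) = \<bar>c\<bar> * N x"
  and is_norm_triangle: "N (x + y) \<le> N x + N y"
  using N by (auto simp: is_norm_def)

lemma is_norm_minus: "N (- x) = N x"
  using is_norm_scaleR[of "-1" x] by simp

lemma is_norm_triangle_sub: "N (x - y) \<le> N x + N y"
  using is_norm_triangle[of x "- y"] by (simp add: is_norm_minus)

lemma is_norm_zero: "N 0 = 0"
  by (simp add: is_norm_eq_0)

lemma is_norm_le_norm: obtains c where "0 < c" "\<And>x. N x \<le> c * norm x"
proof -
  define c where "c = (\<Sum>b\<in>Basis. N b) + 1"
  have "0 < c" unfolding c_def by (intro add_nonneg_pos sum_nonneg is_norm_nonneg) auto
  have "N x \<le> c * norm x" for x
  proof -
    have sub: "N (\<Sum>b\<in>S. f b) \<le> (\<Sum>b\<in>S. N (f b))" if "finite S" for S and f :: "real^'n \<Rightarrow> real^'n"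
      using that
    proof induction
      case (insert a S)
      then show ?case using is_norm_triangle[of "f a" "sum f S"] by auto
    qed (simp add: is_norm_zero)
    have "N x = N (\<Sum>b\<in>Basis. (x \<bullet> b) *\<^sub>R b)" by (simp add: euclidean_representation)
    also have "\<dots> \<le> (\<Sum>b\<in>Basis. \<bar>x \<bullet> b\<bar> * N b)"
      using sub[OF finite_Basis, of "\<lambda>b. (x \<bullet> b) *\<^sub>R b"] by (simp add: is_norm_scaleR)
    also have "\<dots> \<le> (\<Sum>b\<in>Basis. norm x * N b)"
      by (intro sum_mono mult_right_mono is_norm_nonneg Basis_le_norm)
    also have "\<dots> = norm x * (\<Sum>b\<in>Basis. N b)" by (rule sum_distrib_left[symmetric])
    also have "\<dots> \<le> norm x * c" unfolding c_def by (rule mult_left_mono) auto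
    also have "\<dots> = c * norm x" by (rule mult.commute)
    finally show ?thesis .
  qed
  then show thesis using \<open>0 < c\<close> that by blast
qed

lemma is_norm_continuous: "continuous_on S N"
proof -
  obtain c where c: "0 < c" "\<And>x. N x \<le> c * norm x" by (rule is_norm_le_norm) blast
  have "\<bar>N x - N y\<bar> \<le> c * dist x y" for x y
    using is_norm_triangle[of "x - y" y] is_norm_triangle[of "y - x" x] c(2)[of "x - y"] c(2)[of "y - x"]
    by (simp add: dist_norm norm_minus_commute)
  then show ?thesis
    unfolding continuous_on_iff dist_real_def
    by (metis c(1) dist_commute le_less_trans mult.commute pos_less_divide_eq zero_less_divide_iff)
qed

lemma is_norm_continuous_compose:
  "continuous_on S f \<Longrightarrow> continuous_on S (\<lambda>x. N (f x))"
  using continuous_on_compose2[OF is_norm_continuous[of UNIV]] by blast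

lemma norm_le_is_norm: obtains c where "0 < c" "\<And>x. norm x \<le> c * N x"
proof -
  have "\<exists>u\<in>sphere 0 1. \<forall>x\<in>sphere 0 1. N u \<le> N x"
    by (rule continuous_attains_inf) (auto simp: is_norm_continuous intro!: exI[of _ "axis undefined 1"])
  then obtain u where u: "norm u = 1" "\<And>x. norm x = 1 \<Longrightarrow> N u \<le> N x" by auto
  have "0 < N u" using u is_norm_nonneg[of u] is_norm_eq_0[of u] by force
  have "norm x \<le> inverse (N u) * N x" for x
  proof (cases "x = 0")
    case False
    then have "N u \<le> N (inverse (norm x) *\<^sub>R x)" by (intro u) simp
    then show ?thesis using False \<open>0 < N u\<close> by (simp add: is_norm_scaleR field_simps)
  qed (simp add: is_norm_zero)
  then show thesis using \<open>0 < N u\<close> that by (meson inverse_positive_iff_positive)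
qed

lemma is_norm_linear_le:
  assumes "linear (f :: real^'n \<Rightarrow> real^'n)"
  obtains c where "0 < c" "\<And>x. N (f x) \<le> c * N x"
proof -
  obtain c1 where c1: "0 < c1" "\<And>x. N x \<le> c1 * norm x" by (rule is_norm_le_norm) blast
  obtain c2 where c2: "0 < c2" "\<And>x. norm x \<le> c2 * N x" by (rule norm_le_is_norm) blast
  obtain B where B: "0 < B" "\<And>x. norm (f x) \<le> B * norm x" using linear_bounded_pos[OF assms] by blast
  have "N (f x) \<le> (c1 * B * c2) * N x" for x
  proof -
    have "N (f x) \<le> c1 * norm (f x)" by (rule c1)
    also have "\<dots> \<le> c1 * (B * norm x)" by (intro mult_left_mono B) (use c1 in simp)
    also have "\<dots> \<le> c1 * (B * (c2 * N x))" by (intro mult_left_mono c2) (use c1 B in simp_all)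
    finally show ?thesis by (simp add: mult_ac)
  qed
  then show thesis using c1 c2 B by (intro that[of "c1 * B * c2"]) auto
qed

text \<open>A real-valued \<open>SUP\<close> is meaningful only over a nonempty set with bounded
  image. Linearity in finite dimension gives the bound, and scaling passes between unit vectors and
  all vectors.\<close>

lemma matrix_norm_le_iff: "matrix_norm N M \<le> B \<longleftrightarrow> (\<forall>v. N (M *v v) \<le> B * N v)"
proof -
  have "linear ((*v) M)" by simp
  then obtain c where c: "0 < c" "\<And>x. N (M *v x) \<le> c * N x" by (rule is_norm_linear_le) blast
  have bdd: "bdd_above ((\<lambda>x. N (M *v x)) ` {x. N x = 1})"
    using c(2) by (intro bdd_aboveI[of _ c]) (metis (mono_tags) imageE mem_Collect_eq mult.right_neutral)
  have ne: "{x. N x = 1} \<noteq> {}"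
  proof -
    have "N (axis undefined 1) \<noteq> 0" by (simp add: is_norm_eq_0 axis_eq_0_iff)
    then have "N (inverse (N (axis undefined 1)) *\<^sub>R axis undefined 1) = 1"
      by (simp add: is_norm_scaleR is_norm_nonneg)
    then show ?thesis by blast
  qed
  have "matrix_norm N M \<le> B \<longleftrightarrow> (\<forall>x. N x = 1 \<longrightarrow> N (M *v x) \<le> B)"
    unfolding matrix_norm_def using cSUP_le_iff[OF ne bdd] by simp
  also have "\<dots> \<longleftrightarrow> (\<forall>v. N (M *v v) \<le> B * N v)"
  proof safe
    fix v assume *: "\<forall>x. N x = 1 \<longrightarrow> N (M *v x) \<le> B"
    show "N (M *v v) \<le> B * N v"
    proof (cases "v = 0")
      case False
      then have pos: "0 < N v" using is_norm_nonneg[of v] is_norm_eq_0[of v] by linarith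
      have "N (M *v (inverse (N v) *\<^sub>R v)) \<le> B"
        using pos by (intro *[rule_format]) (simp add: is_norm_scaleR)
      then show ?thesis using pos by (simp add: matrix_vector_mult_scaleR is_norm_scaleR field_simps)
    qed (simp add: is_norm_zero)
  qed (metis mult.right_neutral)
  finally show ?thesis .
qed

end

section \<open>Flows on the real line\<close>

text \<open>\<open>Q\<close> acts on initial vectors and is therefore constant in time. The
  estimates compare with the full vector \<open>v\<close> and not with its component, so they also
  contain a uniform bound on the projectors P(t).\<close>

definition exp_dichotomy ::
    "(real^'n \<Rightarrow> real) \<Rightarrow> (real \<Rightarrow> real^'n \<Rightarrow> real^'n) \<Rightarrow> real set \<Rightarrow> bool" where
  "exp_dichotomy N y S \<longleftrightarrow>
     (\<exists>Q K \<alpha>. linear Q \<and> (\<forall>v. Q (Q v) = Q v) \<and> 1 \<le> K \<and> 0 < \<alpha> \<and>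
        (\<forall>v. \<forall>s\<in>S. \<forall>t\<in>S. s \<le> t \<longrightarrow>
           N (y t (Q v)) \<le> K * exp (-\<alpha> * (t - s)) * N (y s v) \<and>
           N (y s (v - Q v)) \<le> K * exp (-\<alpha> * (t - s)) * N (y t v)))"

definition exp_expansive :: "(real^'n \<Rightarrow> real) \<Rightarrow> (real \<Rightarrow> real^'n \<Rightarrow> real^'n) \<Rightarrow> bool" where
  "exp_expansive N y \<longleftrightarrow>
     (\<exists>L \<beta>. 0 < L \<and> 0 < \<beta> \<and>
        (\<forall>v a t b. a \<le> t \<longrightarrow> t \<le> b \<longrightarrow>
           N (y t v) \<le> L * (exp (-\<beta> * (t - a)) * N (y a v) + exp (-\<beta> * (b - t)) * N (y b v))))"

text \<open>A point \<open>u\<close> takes the place of the supremum, which is attained for a flow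
  continuous in time.\<close>

definition noncritical :: "(real^'n \<Rightarrow> real) \<Rightarrow> (real \<Rightarrow> real^'n \<Rightarrow> real^'n) \<Rightarrow> bool" where
  "noncritical N y \<longleftrightarrow>
     (\<exists>T \<theta>. 0 < T \<and> 0 < \<theta> \<and> \<theta> < 1 \<and> (\<forall>v t. \<exists>u\<in>{t - T..t + T}. N (y t v) \<le> \<theta> * N (y u v)))"

text \<open>Reversing time exchanges decaying and growing components, so the complementary
  projection becomes the stable one.\<close>

lemma exp_dichotomy_reflect:
  assumes "exp_dichotomy N (\<lambda>t. y (- t)) {0..}"
  shows "exp_dichotomy N y {..0}"
proof -
  obtain Q K \<alpha> where Q: "linear Q" "\<And>v. Q (Q v) = Q v" "1 \<le> K" "0 < \<alpha>"
    and 1: "\<And>v s t. 0 \<le> s \<Longrightarrow> s \<le> t \<Longrightarrow> N (y (- t) (Q v)) \<le> K * exp (-\<alpha> * (t - s)) * N (y (- s) v)"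
    and 2: "\<And>v s t. 0 \<le> s \<Longrightarrow> s \<le> t \<Longrightarrow> N (y (- s) (v - Q v)) \<le> K * exp (-\<alpha> * (t - s)) * N (y (- t) v)"
    using assms unfolding exp_dichotomy_def by fastforce
  have "linear (\<lambda>v. v - Q v)" using Q(1) by (intro linear_compose_sub linear_id[unfolded id_def])
  moreover have "(v - Q v) - Q (v - Q v) = v - Q v" for v
    using Q by (simp add: linear_diff)
  moreover have "N (y t (v - Q v)) \<le> K * exp (-\<alpha> * (t - s)) * N (y s v)
      \<and> N (y s (v - (v - Q v))) \<le> K * exp (-\<alpha> * (t - s)) * N (y t v)"
    if "s \<in> {..0}" "t \<in> {..0}" "s \<le> t" for v s t
    using 2[of "-t" "-s" v] 1[of "-t" "-s" v] that by simp
  ultimately show ?thesis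
    unfolding exp_dichotomy_def using Q(3,4) by (intro exI[of _ "\<lambda>v. v - Q v"] exI[of _ K] exI[of _ \<alpha>]) blast
qed

lemma noncritical_reflect:
  assumes "noncritical N y"
  shows "noncritical N (\<lambda>t. y (- t))"
proof -
  obtain T \<theta> where T: "0 < T" "0 < \<theta>" "\<theta> < 1"
    and nc: "\<And>v t. \<exists>u\<in>{t - T..t + T}. N (y t v) \<le> \<theta> * N (y u v)"
    using assms unfolding noncritical_def by blast
  have "\<exists>u\<in>{t - T..t + T}. N (y (- t) v) \<le> \<theta> * N (y (- u) v)" for v t
  proof -
    obtain u where "u \<in> {- t - T..- t + T}" "N (y (- t) v) \<le> \<theta> * N (y u v)" using nc by blast
    then show ?thesis by (intro bexI[of _ "- u"]) auto
  qed
  then show ?thesis unfolding noncritical_def using T by blast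
qed

text \<open>On either half-line the claim is immediate from the splitting. If \<open>0\<close> lies between the
  endpoints, then \<open>y 0 v\<close> is controlled by its component growing towards \<open>+\<infinity>\<close> and its component
  growing towards \<open>-\<infinity>\<close>: a vector for which both vanish gives a bounded solution.\<close>

lemma exp_dichotomies_imp_expansive:
  fixes N :: "real^'n \<Rightarrow> real" and y :: "real \<Rightarrow> real^'n \<Rightarrow> real^'n"
  assumes N: "is_norm N" and lin: "\<And>t. linear (y t)" and inj: "inj (y 0)"
    and pos: "exp_dichotomy N y {0..}" and neg: "exp_dichotomy N y {..0}"
    and unbdd: "\<And>v B. (\<And>t. N (y t v) \<le> B) \<Longrightarrow> v = 0"
  shows "exp_expansive N y"
proof -
  note N_nonneg = is_norm_nonneg[OF N]
  obtain P K1 \<alpha>1 where P: "linear P" "\<And>v. P (P v) = P v" "1 \<le> K1" "0 < \<alpha>1"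
    and P1: "\<And>v s t. 0 \<le> s \<Longrightarrow> s \<le> t \<Longrightarrow> N (y t (P v)) \<le> K1 * exp (-\<alpha>1 * (t - s)) * N (y s v)"
    and P2: "\<And>v s t. 0 \<le> s \<Longrightarrow> s \<le> t \<Longrightarrow> N (y s (v - P v)) \<le> K1 * exp (-\<alpha>1 * (t - s)) * N (y t v)"
    using pos unfolding exp_dichotomy_def by fastforce
  obtain Q K2 \<alpha>2 where Q: "linear Q" "\<And>v. Q (Q v) = Q v" "1 \<le> K2" "0 < \<alpha>2"
    and Q1: "\<And>v s t. s \<le> t \<Longrightarrow> t \<le> 0 \<Longrightarrow> N (y t (Q v)) \<le> K2 * exp (-\<alpha>2 * (t - s)) * N (y s v)"
    and Q2: "\<And>v s t. s \<le> t \<Longrightarrow> t \<le> 0 \<Longrightarrow> N (y s (v - Q v)) \<le> K2 * exp (-\<alpha>2 * (t - s)) * N (y t v)"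
    using neg unfolding exp_dichotomy_def by fastforce
  define K \<alpha> where "K = max K1 K2" and "\<alpha> = min \<alpha>1 \<alpha>2"
  have K: "1 \<le> K" "K1 \<le> K" "K2 \<le> K" and \<alpha>: "0 < \<alpha>" "\<alpha> \<le> \<alpha>1" "\<alpha> \<le> \<alpha>2"
    using P Q by (auto simp: K_def \<alpha>_def)
  define e where "e d = exp (-\<alpha> * d)" for d
  have e_pos: "0 < e d" and e_add: "e (c + d) = e c * e d" for c d
    by (simp_all add: e_def distrib_left flip: exp_add)
  have e_mono: "e d \<le> e c" if "c \<le> d" for c d
    using that \<alpha> by (simp add: e_def)
  have weaken: "X \<le> K * e d * Z" if "X \<le> K' * exp (-\<alpha>' * d) * Z" "1 \<le> K'" "K' \<le> K" "\<alpha> \<le> \<alpha>'" "0 \<le> d" "0 \<le> Z"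
    for X Z K' \<alpha>' d
  proof -
    have "exp (-\<alpha>' * d) \<le> e d" using that by (simp add: e_def mult_right_mono)
    then have "K' * exp (-\<alpha>' * d) * Z \<le> K * e d * Z"
      using that K by (intro mult_right_mono mult_mono) auto
    with that show ?thesis by linarith
  qed
  have P1': "N (y t (P v)) \<le> K * e (t - s) * N (y s v)"
    and P2': "N (y s (v - P v)) \<le> K * e (t - s) * N (y t v)" if "0 \<le> s" "s \<le> t" for v s t
    using that by (auto intro: weaken[OF P1] weaken[OF P2] simp: P K \<alpha> N_nonneg)
  have Q1': "N (y t (Q v)) \<le> K * e (t - s) * N (y s v)"
    and Q2': "N (y s (v - Q v)) \<le> K * e (t - s) * N (y t v)" if "s \<le> t" "t \<le> 0" for v s t
    using that by (auto intro: weaken[OF Q1] weaken[OF Q2] simp: Q K \<alpha> N_nonneg)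
  have splitP: "N (y t v) \<le> N (y t (P v)) + N (y t (v - P v))" for t v
    using is_norm_triangle[OF N, of "y t (P v)" "y t (v - P v)"] by (simp add: linear_add[OF lin, symmetric])
  have splitQ: "N (y t v) \<le> N (y t (Q v)) + N (y t (v - Q v))" for t v
    using is_norm_triangle[OF N, of "y t (Q v)" "y t (v - Q v)"] by (simp add: linear_add[OF lin, symmetric])
  \<comment> \<open>The two components together form a linear map \<open>f\<close> into a product
    space. An injective linear map in finite dimension is bounded below, and the comparison of norms
    turns this into \<open>c\<close>.\<close>
  obtain c where c: "0 < c" "\<And>v. N (y 0 v) \<le> c * (N (y 0 (v - P v)) + N (y 0 (Q v)))"
  proof -
    define f where "f v = (y 0 (v - P v), y 0 (Q v))" for v
    have f: "linear f"
      unfolding f_def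
      by (rule linearI) (simp_all add: linear_add[OF lin] linear_diff[OF lin] linear_scale[OF lin]
          linear_add[OF P(1)] linear_scale[OF P(1)] linear_add[OF Q(1)] linear_scale[OF Q(1)]
          scaleR_right_diff_distrib)
    \<comment> \<open>Here \<open>P v = v\<close> bounds the orbit on the right half-line and
      \<open>Q v = 0\<close> bounds it on the left one.\<close>
    have "v = 0" if "f v = 0" for v
    proof (rule unbdd)
      have "y 0 (v - P v) = y 0 0" "y 0 (Q v) = y 0 0"
        using that by (auto simp: f_def zero_prod_def linear_0[OF lin])
      then have "v - P v = 0" and "Q v = 0" using inj by (meson injD)+
      then have "P v = v" by simp
      fix t
      show "N (y t v) \<le> K * N (y 0 v)"
      proof (cases "0 \<le> t")
        case True
        have "N (y t v) \<le> K * e t * N (y 0 v)" using P1'[of 0 t v] True \<open>P v = v\<close> by simp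
        also have "\<dots> \<le> K * 1 * N (y 0 v)"
          using e_mono[OF True] K N_nonneg by (intro mult_right_mono mult_left_mono) (auto simp: e_def)
        finally show ?thesis by simp
      next
        case False
        have "N (y t v) \<le> K * e (- t) * N (y 0 v)" using Q2'[of t 0 v] False \<open>Q v = 0\<close> by simp
        also have "\<dots> \<le> K * 1 * N (y 0 v)"
          using e_mono[of 0 "-t"] False K N_nonneg by (intro mult_right_mono mult_left_mono) (auto simp: e_def)
        finally show ?thesis by simp
      qed
    qed
    then have "inj f" using linear_injective_0[OF f] by blast
    then obtain B where B: "B > 0" "\<And>v. B * norm v \<le> norm (f v)"
      using linear_inj_bounded_below_pos[OF f] by blast
    obtain c1 where c1: "0 < c1" "\<And>v. N (y 0 v) \<le> c1 * N v"
      by (rule is_norm_linear_le[OF N lin[of 0]]) blast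
    obtain c2 where c2: "0 < c2" "\<And>v. N v \<le> c2 * norm v" by (rule is_norm_le_norm[OF N]) blast
    obtain c3 where c3: "0 < c3" "\<And>v. norm v \<le> c3 * N v" by (rule norm_le_is_norm[OF N]) blast
    have "N (y 0 v) \<le> (c1 * c2 * c3 / B) * (N (y 0 (v - P v)) + N (y 0 (Q v)))" for v
    proof -
      have "B * norm v \<le> norm (y 0 (v - P v)) + norm (y 0 (Q v))"
        using B(2)[of v] norm_Pair_le order_trans unfolding f_def by blast
      also have "\<dots> \<le> c3 * (N (y 0 (v - P v)) + N (y 0 (Q v)))"
        using c3(2) by (simp add: distrib_left add_mono)
      finally have "norm v \<le> c3 / B * (N (y 0 (v - P v)) + N (y 0 (Q v)))"
        using \<open>B > 0\<close> by (simp add: field_simps)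
      moreover have "N (y 0 v) \<le> c1 * (c2 * norm v)"
        using c1 c2 by (meson mult_left_mono order_trans less_imp_le)
      ultimately have "N (y 0 v) \<le> c1 * (c2 * (c3 / B * (N (y 0 (v - P v)) + N (y 0 (Q v)))))"
        using c1 c2 by (meson mult_left_mono order_trans less_imp_le)
      then show ?thesis by simp
    qed
    then show thesis using c1 c2 c3 B by (intro that[of "c1 * c2 * c3 / B"]) auto
  qed
  \<comment> \<open>\<open>c * K * K\<close> pays for an estimate routed through time 0, the extra
    \<open>K\<close> for the component estimated directly from an endpoint.\<close>
  define L where "L = c * K * K + K"
  have L: "K \<le> L" "0 < L" using c K by (auto simp: L_def intro: add_nonneg_pos)
  have mid: "N (y 0 v) \<le> c * K * (e (- a) * N (y a v) + e b * N (y b v))" if "a \<le> 0" "0 \<le> b" for a b v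
  proof -
    have "N (y 0 (v - P v)) + N (y 0 (Q v)) \<le> K * (e (- a) * N (y a v) + e b * N (y b v))"
      using P2'[of 0 b v] Q1'[of a 0 v] that by (simp add: algebra_simps)
    then have "c * (N (y 0 (v - P v)) + N (y 0 (Q v))) \<le> c * (K * (e (- a) * N (y a v) + e b * N (y b v)))"
      using c(1) by (intro mult_left_mono) auto
    then show ?thesis using c(2)[of v] by (simp only: mult.assoc)
  qed
  have final: "N (y t v) \<le> L * (e (t - a) * N (y a v) + e (b - t) * N (y b v))"
    if t: "a \<le> t" "t \<le> b" for a t b v
  proof -
    let ?X = "N (y a v)" and ?Z = "N (y b v)"
    have XZ: "0 \<le> ?X" "0 \<le> ?Z" by (rule N_nonneg)+
    have eX: "0 \<le> e (t - a) * ?X" and eZ: "0 \<le> e (b - t) * ?Z"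
      using XZ e_pos by (simp_all add: less_imp_le)
    have KL: "K * (e (t - a) * ?X + e (b - t) * ?Z) \<le> L * (e (t - a) * ?X + e (b - t) * ?Z)"
      using L eX eZ by (intro mult_right_mono) auto
    \<comment> \<open>If 0 lies outside the interval, one dichotomy suffices. Otherwise the
      component that would be estimated across 0 is first compared with \<open>y 0 v\<close>, and
      \<open>mid\<close> takes over from there.\<close>
    consider "0 \<le> a" | "b \<le> 0" | "a \<le> 0" "0 \<le> t" | "t \<le> 0" "0 \<le> b" using t by linarith
    then show ?thesis
    proof cases
      case 1
      then show ?thesis using splitP[of t v] P1'[of a t v] P2'[of t b v] t KL by (simp add: algebra_simps)
    next
      case 2
      then show ?thesis using splitQ[of t v] Q1'[of a t v] Q2'[of t b v] t KL by (simp add: algebra_simps)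
    next
      case 3
      have "N (y t v) \<le> K * e t * N (y 0 v) + K * e (b - t) * ?Z"
        using splitP[of t v] P1'[of 0 t v] P2'[of t b v] 3 t by simp
      also have "K * e t * N (y 0 v) \<le> K * e t * (c * K * (e (- a) * ?X + e b * ?Z))"
        using mid[of a b v] 3 t K e_pos[of t] by (intro mult_left_mono) auto
      also have "\<dots> = c * K * K * (e (t - a) * ?X + e (t + b) * ?Z)"
        unfolding diff_conv_add_uminus e_add by (simp add: algebra_simps)
      \<comment> \<open>The detour through 0 only helps at \<open>b\<close>: for nonnegative
        \<open>t\<close> the distance \<open>t + b\<close> is at least \<open>b - t\<close>. Case 4
        mirrors this at \<open>a\<close>.\<close>
      also have "\<dots> \<le> c * K * K * (e (t - a) * ?X + e (b - t) * ?Z)"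
        using e_mono[of "b - t" "t + b"] 3 c K XZ
        by (intro mult_left_mono add_left_mono mult_right_mono) auto
      finally have "N (y t v) \<le> c * K * K * (e (t - a) * ?X + e (b - t) * ?Z) + K * (e (b - t) * ?Z)"
        by (simp add: mult.assoc)
      also have "\<dots> \<le> L * (e (t - a) * ?X + e (b - t) * ?Z)"
        using K eX by (simp add: L_def algebra_simps)
      finally show ?thesis .
    next
      case 4
      have "N (y t v) \<le> K * e (t - a) * ?X + K * e (- t) * N (y 0 v)"
        using splitQ[of t v] Q1'[of a t v] Q2'[of t 0 v] 4 t by simp
      also have "K * e (- t) * N (y 0 v) \<le> K * e (- t) * (c * K * (e (- a) * ?X + e b * ?Z))"
        using mid[of a b v] 4 t K e_pos[of "-t"] by (intro mult_left_mono) auto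
      also have "\<dots> = c * K * K * (e (- t - a) * ?X + e (b - t) * ?Z)"
        unfolding diff_conv_add_uminus e_add by (simp add: algebra_simps)
      also have "\<dots> \<le> c * K * K * (e (t - a) * ?X + e (b - t) * ?Z)"
        using e_mono[of "t - a" "- t - a"] 4 c K XZ
        by (intro mult_left_mono add_right_mono mult_right_mono) auto
      finally have "N (y t v) \<le> c * K * K * (e (t - a) * ?X + e (b - t) * ?Z) + K * (e (t - a) * ?X)"
        by (simp add: mult.assoc)
      also have "\<dots> \<le> L * (e (t - a) * ?X + e (b - t) * ?Z)"
        using K eZ by (simp add: L_def algebra_simps)
      finally show ?thesis .
    qed
  qed
  show ?thesis
    unfolding exp_expansive_def using L \<alpha> final unfolding e_def by blast
qed

lemma exp_expansive_imp_noncritical: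
  assumes N: "is_norm N" and "exp_expansive N y"
  shows "noncritical N y"
proof -
  obtain L \<beta> where L: "0 < L" "0 < \<beta>"
    and ex: "\<And>v a t b. a \<le> t \<Longrightarrow> t \<le> b \<Longrightarrow>
      N (y t v) \<le> L * (exp (-\<beta> * (t - a)) * N (y a v) + exp (-\<beta> * (b - t)) * N (y b v))"
    using assms(2) unfolding exp_expansive_def by blast
  \<comment> \<open>Makes L exp(-\<beta> T) at most 1/4; the added 1 keeps the logarithm positive.
    Then one of the two endpoint values is at least twice the middle one, which gives the factor
    1/2.\<close>
  define T where "T = ln (4 * L + 1) / \<beta>"
  have T: "0 < T" using L by (simp add: T_def)
  have "exp (- \<beta> * T) = inverse (4 * L + 1)" using L by (simp add: T_def exp_minus)
  then have eT: "L * exp (- \<beta> * T) \<le> 1 / 4" using L by (simp only:) (simp add: field_simps)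
  have "\<exists>u\<in>{t - T..t + T}. N (y t v) \<le> 1 / 2 * N (y u v)" for v t
  proof -
    have "N (y t v) \<le> (L * exp (- \<beta> * T)) * (N (y (t - T) v) + N (y (t + T) v))"
      using ex[of "t - T" t "t + T" v] T by (simp add: algebra_simps)
    also have "\<dots> \<le> 1 / 4 * (N (y (t - T) v) + N (y (t + T) v))"
      using eT is_norm_nonneg[OF N] by (intro mult_right_mono) auto
    finally have "4 * N (y t v) \<le> N (y (t - T) v) + N (y (t + T) v)" by simp
    then have "N (y t v) \<le> 1 / 2 * N (y (t - T) v) \<or> N (y t v) \<le> 1 / 2 * N (y (t + T) v)"
      by (intro disjCI) linarith
    then show ?thesis using T by fastforce
  qed
  then show ?thesis
    unfolding noncritical_def using T by (intro exI[of _ T] exI[of _ "1/2"]) auto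
qed

section \<open>Noncriticality on a half-line\<close>

text \<open>Turns a factor \<theta> per full period \<open>T\<close> into the exponential rate - ln
  \<theta> / T; the incomplete last period costs \<open>inverse \<theta>\<close>.\<close>

lemma geometric_le_exp:
  fixes \<theta> T d :: real
  assumes "0 < \<theta>" "\<theta> < 1" "0 < T" "0 \<le> d"
  obtains k :: nat where "k * T \<le> d" "\<theta> ^ k \<le> inverse \<theta> * exp (- (- ln \<theta> / T) * d)"
proof -
  define k where "k = nat \<lfloor>d / T\<rfloor>"
  have "real k = \<lfloor>d / T\<rfloor>" using assms by (simp add: k_def)
  then have k: "real k \<le> d / T" "d / T < real k + 1" by linarith+
  have "ln \<theta> * (real k + 1) \<le> ln \<theta> * (d / T)"
    using k assms by (intro mult_left_mono_neg) auto
  then have "exp (ln \<theta> * (real k + 1)) \<le> exp (- (- ln \<theta> / T) * d)" by simp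
  moreover have "exp (ln \<theta> * (real k + 1)) = \<theta> ^ Suc k"
    using assms by (simp add: distrib_left exp_add exp_of_nat2_mult)
  ultimately have "inverse \<theta> * \<theta> ^ Suc k \<le> inverse \<theta> * exp (- (- ln \<theta> / T) * d)"
    using assms by (intro mult_left_mono) auto
  then have "\<theta> ^ k \<le> inverse \<theta> * exp (- (- ln \<theta> / T) * d)"
    using assms by (simp only: power_Suc mult.assoc[symmetric]) simp
  moreover have "k * T \<le> d" using k assms by (simp add: field_simps)
  ultimately show thesis using that by blast
qed

text \<open>The Euclidean orthogonal complement is a convenient choice of \<open>W\<close>.
  Uniqueness of the decomposition yields linearity and idempotence of \<open>Q\<close>.\<close>

lemma subspace_projection:
  fixes V :: "'a::euclidean_space set"
  assumes "subspace V"
  obtains Q W where "linear Q" "\<And>v. Q v \<in> V" "\<And>v. Q (Q v) = Q v" "\<And>v. v - Q v \<in> W"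
    "subspace W" "V \<inter> W = {0}"
proof -
  define W where "W = {z. \<forall>w\<in>V. orthogonal w z}"
  have W: "subspace W" unfolding W_def by (rule subspace_orthogonal_to_vectors)
  have VW: "V \<inter> W = {0}"
    using assms subspace_0[OF W] subspace_0 by (auto simp: W_def orthogonal_self)
  have "\<exists>q\<in>V. v - q \<in> W" for v
  proof -
    obtain q z where "q \<in> span V" "\<And>w. w \<in> span V \<Longrightarrow> orthogonal z w" "v = q + z"
      by (rule orthogonal_subspace_decomp_exists) blast
    then show ?thesis
      using assms by (intro bexI[of _ q]) (auto simp: W_def orthogonal_commute span_eq_iff[THEN iffD2])
  qed
  then obtain Q where Q: "\<And>v. Q v \<in> V" "\<And>v. v - Q v \<in> W" by metis
  have uniq: "Q v = q" if "q \<in> V" "v - q \<in> W" for v q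
  proof -
    have "Q v - q \<in> V" using Q that assms by (intro subspace_diff)
    moreover have "(v - q) - (v - Q v) \<in> W" using subspace_diff[OF W that(2) Q(2)] .
    ultimately have "Q v - q \<in> V \<inter> W" by simp
    then show ?thesis using VW by simp
  qed
  have "linear Q"
  proof (rule linearI)
    fix u v
    have "(u - Q u) + (v - Q v) \<in> W" using Q W by (intro subspace_add)
    then show "Q (u + v) = Q u + Q v"
      using Q assms by (intro uniq subspace_add) (auto simp: algebra_simps)
  next
    fix c v
    have "c *\<^sub>R (v - Q v) \<in> W" using Q W by (intro subspace_scale)
    then show "Q (c *\<^sub>R v) = c *\<^sub>R Q v"
      using Q assms by (intro uniq subspace_scale) (auto simp: algebra_simps)
  qed
  moreover have "Q (Q v) = Q v" for v using Q W by (intro uniq) (auto simp: subspace_0)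
  ultimately show thesis using Q W VW that by blast
qed

text \<open>\<open>crit\<close> starts at \<open>T\<close> so that its window stays in the
  half-line. \<open>growth\<close> covers the same length \<open>T\<close>, enough to follow a jump
  of \<open>crit\<close> that leaves an interval on the right.\<close>

locale half_line_noncritical =
  fixes N :: "real^'n \<Rightarrow> real" and y :: "real \<Rightarrow> real^'n \<Rightarrow> real^'n" and T \<theta> C :: real
  assumes N: "is_norm N" and lin: "linear (y t)"
    and cont: "continuous_on {0..} (\<lambda>t. y t v)"
    and T: "0 < T" and \<theta>: "0 < \<theta>" "\<theta> < 1"
    and crit: "T \<le> t \<Longrightarrow> \<exists>u\<in>{t - T..t + T}. N (y t v) \<le> \<theta> * N (y u v)"
    and C: "1 \<le> C"
    and growth: "0 \<le> s \<Longrightarrow> s \<le> t \<Longrightarrow> t \<le> s + T \<Longrightarrow> N (y t v) \<le> C * N (y s v)"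
begin

lemma N_nonneg: "0 \<le> N v"
  by (rule is_norm_nonneg[OF N])

text \<open>A maximum point in \<open>(a + T, b]\<close> sees a larger value within distance \<open>T\<close>, which can
  only be attained beyond \<open>b\<close>, where growth applies.\<close>

lemma max_principle:
  assumes "0 \<le> a" "a \<le> r" "r \<le> b"
  shows "N (y r v) \<le> C * max (N (y a v)) (N (y b v))"
proof -
  have "continuous_on {a..b} (\<lambda>t. N (y t v))"
    using assms by (intro is_norm_continuous_compose[OF N] continuous_on_subset[OF cont]) auto
  then obtain t where t: "a \<le> t" "t \<le> b" and max: "\<And>s. a \<le> s \<Longrightarrow> s \<le> b \<Longrightarrow> N (y s v) \<le> N (y t v)"
    using continuous_attains_sup[of "{a..b}" "\<lambda>t. N (y t v)"] assms by auto
  have "N (y t v) \<le> C * N (y a v) \<or> N (y t v) \<le> C * N (y b v)"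
  proof (cases "t \<le> a + T")
    case True
    then show ?thesis using growth[of a t v] t assms by auto
  next
    case False
    then obtain u where u: "t - T \<le> u" "u \<le> t + T" "N (y t v) \<le> \<theta> * N (y u v)"
      using crit[of t v] assms by auto
    show ?thesis
    \<comment> \<open>A point \<open>u\<close> inside the interval cannot exceed the maximum, so
      \<theta> < 1 forces the maximum to be 0; otherwise \<open>u\<close> is within \<open>T\<close>
      of \<open>b\<close>.\<close>
    proof (cases "u \<le> b")
      case True
      then have "N (y u v) \<le> N (y t v)" using max u False by auto
      then have "N (y t v) \<le> \<theta> * N (y t v)" using u(3) \<theta> by (smt (verit) mult_left_mono)
      then have "N (y t v) = 0" using \<theta> N_nonneg[of "y t v"] mult_strict_right_mono[of \<theta> 1 "N (y t v)"] by linarith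
      then show ?thesis using C N_nonneg[of "y b v"] by simp
    next
      case False
      have "N (y t v) \<le> 1 * N (y u v)"
        using u(3) \<theta> N_nonneg[of "y u v"] mult_right_mono[of \<theta> 1] by fastforce
      also have "1 * N (y u v) \<le> C * N (y b v)" using growth[of b u v] False u t assms by auto
      finally show ?thesis by simp
    qed
  qed
  moreover have "C * N (y a v) \<le> C * max (N (y a v)) (N (y b v))"
    "C * N (y b v) \<le> C * max (N (y a v)) (N (y b v))"
    using C by (auto intro!: mult_left_mono)
  ultimately show ?thesis using max[of r] assms by linarith
qed

text \<open>Each jump moves left by at most \<open>T\<close>, so starting at or beyond
  \<open>k * T\<close> leaves room for \<open>crit\<close> at every one of the \<open>k\<close>
  jumps.\<close>

lemma crit_iterate:
  assumes "real k * T \<le> t"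
  shows "\<exists>u\<in>{t - k * T..t + k * T}. N (y t v) \<le> \<theta> ^ k * N (y u v)"
  using assms
proof (induction k arbitrary: t)
  case 0
  then show ?case by auto
next
  case (Suc k)
  have kT: "0 \<le> real k * T" using T by simp
  have "T \<le> t" using Suc.prems kT by (simp add: algebra_simps)
  then obtain u where u: "t - T \<le> u" "u \<le> t + T" "N (y t v) \<le> \<theta> * N (y u v)"
    using crit by force
  have "k * T \<le> u" using u Suc.prems by (simp add: algebra_simps)
  then obtain w where w: "u - k * T \<le> w" "w \<le> u + k * T" "N (y u v) \<le> \<theta> ^ k * N (y w v)"
    using Suc.IH by force
  have "N (y t v) \<le> \<theta> * (\<theta> ^ k * N (y w v))"
    using u(3) mult_left_mono[OF w(3), of \<theta>] \<theta> by linarith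
  then show ?case using u w by (intro bexI[of _ w]) (auto simp: algebra_simps)
qed

text \<open>The future stable subspace, described by boundedness because that is visibly a linear
  condition; decay is derived from it afterwards.\<close>

definition "bounded_orbits = {v. \<exists>B. \<forall>t\<ge>0. N (y t v) \<le> B}"

lemma subspace_bounded_orbits: "subspace bounded_orbits"
proof (rule subspaceI)
  show "0 \<in> bounded_orbits" using is_norm_zero[OF N] by (auto simp: bounded_orbits_def linear_0[OF lin])
next
  fix u v assume "u \<in> bounded_orbits" "v \<in> bounded_orbits"
  then obtain B B' where "\<And>t. 0 \<le> t \<Longrightarrow> N (y t u) \<le> B" "\<And>t. 0 \<le> t \<Longrightarrow> N (y t v) \<le> B'"
    unfolding bounded_orbits_def by blast
  then have "N (y t (u + v)) \<le> B + B'" if "0 \<le> t" for t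
    using is_norm_triangle[OF N, of "y t u" "y t v"] that
    by (simp add: linear_add[OF lin]) (smt (verit))
  then show "u + v \<in> bounded_orbits" unfolding bounded_orbits_def by blast
next
  fix c v assume "v \<in> bounded_orbits"
  then obtain B where "\<And>t. 0 \<le> t \<Longrightarrow> N (y t v) \<le> B" unfolding bounded_orbits_def by blast
  then have "N (y t (c *\<^sub>R v)) \<le> \<bar>c\<bar> * B" if "0 \<le> t" for t
    using that by (simp add: linear_scale[OF lin] is_norm_scaleR[OF N] mult_left_mono)
  then show "c *\<^sub>R v \<in> bounded_orbits" unfolding bounded_orbits_def by blast
qed

text \<open>The maximum principle on [s, t + kT] has a right endpoint value of at most \<theta>^k B,
  since iterated jumps from there still land where the orbit is bounded by \<open>B\<close>. As k
  grows, only the left endpoint survives.\<close>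

lemma bounded_orbit_bound:
  assumes "v \<in> bounded_orbits" "0 \<le> s" "s \<le> t"
  shows "N (y t v) \<le> C * N (y s v)"
proof -
  obtain B where B: "\<And>t. 0 \<le> t \<Longrightarrow> N (y t v) \<le> B" using assms unfolding bounded_orbits_def by blast
  have B0: "0 \<le> B" using B[of 0] N_nonneg[of "y 0 v"] by linarith
  have "N (y t v) \<le> C * (N (y s v) + \<theta> ^ k * B)" for k
  proof -
    define b where "b = t + k * T"
    have kT: "0 \<le> k * T" using T by simp
    obtain u where u: "b - k * T \<le> u" "N (y b v) \<le> \<theta> ^ k * N (y u v)"
      using crit_iterate[of k b v] assms b_def by auto
    have "\<theta> ^ k * N (y u v) \<le> \<theta> ^ k * B"
      using B[of u] u assms \<theta> by (intro mult_left_mono) (auto simp: b_def)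
    moreover have "0 \<le> \<theta> ^ k * B" using \<theta> B0 by simp
    ultimately have "max (N (y s v)) (N (y b v)) \<le> N (y s v) + \<theta> ^ k * B"
      using u N_nonneg[of "y s v"] by linarith
    then have "C * max (N (y s v)) (N (y b v)) \<le> C * (N (y s v) + \<theta> ^ k * B)"
      using C by (intro mult_left_mono) auto
    then show ?thesis using max_principle[of s t b v] assms kT by (auto simp: b_def)
  qed
  moreover have "(\<lambda>k. C * (N (y s v) + \<theta> ^ k * B)) \<longlonglongrightarrow> C * (N (y s v) + 0 * B)"
    using \<theta> by (intro tendsto_intros LIMSEQ_power_zero) auto
  ultimately show ?thesis by (intro LIMSEQ_le_const) auto
qed

text \<open>As many jumps are made as fit between \<open>s\<close> and \<open>t\<close>. The landing
  point is then not before \<open>s\<close>, where the uniform bound applies.\<close>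

lemma bounded_orbit_decay:
  assumes "v \<in> bounded_orbits" "0 \<le> s" "s \<le> t"
  shows "N (y t v) \<le> C / \<theta> * exp (- (- ln \<theta> / T) * (t - s)) * N (y s v)"
proof -
  obtain k :: nat where k: "k * T \<le> t - s" "\<theta> ^ k \<le> inverse \<theta> * exp (- (- ln \<theta> / T) * (t - s))"
    using geometric_le_exp[OF \<theta> T, of "t - s"] assms by auto
  obtain u where u: "t - k * T \<le> u" "N (y t v) \<le> \<theta> ^ k * N (y u v)"
    using crit_iterate[of k t v] k assms by auto
  have "\<theta> ^ k * N (y u v) \<le> \<theta> ^ k * (C * N (y s v))"
    using \<theta> bounded_orbit_bound[of v s u] assms u k by (intro mult_left_mono) auto
  also have "\<dots> \<le> inverse \<theta> * exp (- (- ln \<theta> / T) * (t - s)) * (C * N (y s v))"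
    using C N_nonneg k by (intro mult_right_mono) auto
  finally show ?thesis using u by (simp add: field_simps)
qed

end

text \<open>The argument follows Coppel. Vectors in a complement \<open>W\<close> of the stable space give unbounded
  solutions; by compactness of the unit sphere of \<open>W\<close> they exceed a fixed level before a common
  time, and the maximum principle then keeps them from becoming small later.\<close>

lemma half_line_exp_dichotomy:
  fixes N :: "real^'n \<Rightarrow> real" and y :: "real \<Rightarrow> real^'n \<Rightarrow> real^'n"
  assumes N: "is_norm N" and lin: "\<And>t. linear (y t)"
    and cont: "\<And>v. continuous_on {0..} (\<lambda>t. y t v)"
    and crit: "noncritical N y"
    and bounded_growth: "\<And>S. 0 < S \<Longrightarrow> \<exists>C\<ge>1. \<forall>v. \<forall>s\<ge>0. \<forall>t\<in>{s..s + S}. N (y t v) \<le> C * N (y s v)"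
  shows "exp_dichotomy N y {0..}"
proof -
  obtain T \<theta> where T: "0 < T" and \<theta>: "0 < \<theta>" "\<theta> < 1"
    and "\<And>v t. \<exists>u\<in>{t - T..t + T}. N (y t v) \<le> \<theta> * N (y u v)"
    using crit unfolding noncritical_def by blast
  moreover obtain C where C: "1 \<le> C" "\<And>v s t. 0 \<le> s \<Longrightarrow> s \<le> t \<Longrightarrow> t \<le> s + T \<Longrightarrow> N (y t v) \<le> C * N (y s v)"
    using bounded_growth[OF T] by (meson atLeastAtMost_iff)
  ultimately have "half_line_noncritical N y T \<theta> C"
    by (intro half_line_noncritical.intro N lin cont) auto
  then interpret half_line_noncritical N y T \<theta> C .
  obtain Q W where Q: "linear Q" "\<And>v. Q v \<in> bounded_orbits" "\<And>v. Q (Q v) = Q v" "\<And>v. v - Q v \<in> W"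
    and W: "subspace W" "bounded_orbits \<inter> W = {0}"
    using subspace_projection[OF subspace_bounded_orbits] by metis
  obtain B0 where B0: "0 < B0" "\<And>v. N (y 0 v) \<le> B0 * norm v"
  proof -
    obtain c1 where "0 < c1" "\<And>v. N (y 0 v) \<le> c1 * N v"
      by (rule is_norm_linear_le[OF N lin[of 0]]) blast
    moreover obtain c2 where "0 < c2" "\<And>v. N v \<le> c2 * norm v" by (rule is_norm_le_norm[OF N]) blast
    ultimately have "N (y 0 v) \<le> c1 * c2 * norm v" for v
      by (metis less_imp_le mult.assoc mult_left_mono order_trans)
    then show thesis using \<open>0 < c1\<close> \<open>0 < c2\<close> that[of "c1 * c2"] by simp
  qed
  \<comment> \<open>The level is \<open>C * B0\<close> because \<open>max_principle\<close> loses a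
    factor \<open>C\<close> and \<open>B0\<close> bounds the initial value of a unit vector: above
    this level the left endpoint can no longer account for the maximum.\<close>
  obtain k :: nat where k: "\<And>v. v \<in> W \<Longrightarrow> norm v = 1 \<Longrightarrow> \<exists>t\<in>{0..real k}. C * B0 < N (y t v)"
  proof -
    define F where "F k = {v \<in> W \<inter> sphere 0 1. \<forall>t\<in>{0..real k}. N (y t v) \<le> C * B0}" for k :: nat
    have cpt: "compact (F k)" for k
    proof -
      have "closed {v. N (y t v) \<le> C * B0}" for t
        by (intro closed_Collect_le continuous_intros is_norm_continuous_compose[OF N]
            linear_continuous_on linear_conv_bounded_linear[THEN iffD1] lin)
      then have "closed (\<Inter>t\<in>{0..real k}. {v. N (y t v) \<le> C * B0})" by (intro closed_INT) blast
      moreover have "compact (W \<inter> sphere 0 1)"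
        using closed_subspace[OF W(1)] by (intro closed_Int_compact compact_sphere)
      moreover have "F k = (W \<inter> sphere 0 1) \<inter> (\<Inter>t\<in>{0..real k}. {v. N (y t v) \<le> C * B0})"
        by (auto simp: F_def)
      ultimately show ?thesis by (simp add: compact_Int_closed)
    qed
    \<comment> \<open>A point common to the nested compact sets \<open>F k\<close> would be a unit
      vector of \<open>W\<close> with a bounded orbit.\<close>
    have "\<exists>k. F k = {}"
    proof (rule ccontr)
      assume ne: "\<nexists>k. F k = {}"
      have "\<Inter>(range F) \<noteq> {}"
      proof (rule compact_nest[OF cpt])
        show "F n \<noteq> {}" for n using ne by blast
        show "F n \<subseteq> F m" if "m \<le> n" for m n
          using that unfolding F_def by fastforce
      qed
      then obtain v where v: "\<And>k. v \<in> F k" by blast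
      have "N (y t v) \<le> C * B0" if "0 \<le> t" for t
        using v[of "nat \<lceil>t\<rceil>"] that real_nat_ceiling_ge[of t] unfolding F_def by auto
      then have "v \<in> bounded_orbits" unfolding bounded_orbits_def by blast
      moreover have "v \<in> W" "norm v = 1" using v[of 0] by (simp_all add: F_def)
      ultimately have "v = 0" using W(2) by blast
      then show False using \<open>norm v = 1\<close> by simp
    qed
    then obtain k where k: "F k = {}" by blast
    have "\<exists>t\<in>{0..real k}. C * B0 < N (y t v)" if "v \<in> W" "norm v = 1" for v
    proof -
      have "v \<notin> F k" using k by simp
      then show ?thesis using that by (auto simp: F_def not_le)
    qed
    then show thesis by (rule that)
  qed
  \<comment> \<open>\<open>k\<close> may be 0, while bounded growth is given for positive lengths
    only.\<close>
  have "0 < real k + 1" by simp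
  from bounded_growth[OF this] obtain C' where C': "1 \<le> C'" "\<And>v s t. 0 \<le> s \<Longrightarrow> s \<le> t \<Longrightarrow> t \<le> s + (real k + 1) \<Longrightarrow> N (y t v) \<le> C' * N (y s v)"
    by (meson atLeastAtMost_iff)
  have W_lower: "N (y 0 v) \<le> C' * N (y s v)" if "v \<in> W" "0 \<le> s" for v s
  proof -
    have late: "B0 < N (y s v)" if v: "v \<in> W" "norm v = 1" and s: "real k \<le> s" for v s
    proof -
      obtain t where t: "0 \<le> t" "t \<le> real k" "C * B0 < N (y t v)" using k[OF v] by auto
      then have "C * B0 < C * max (N (y 0 v)) (N (y s v))"
        using max_principle[of 0 t s v] s by auto
      then have "B0 < max (N (y 0 v)) (N (y s v))" using C by simp
      moreover have "N (y 0 v) \<le> B0" using B0(2)[of v] v by simp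
      ultimately show ?thesis by simp
    qed
    have unit: "B0 \<le> C' * N (y s v)" if v: "v \<in> W" "norm v = 1" for v
    proof -
      \<comment> \<open>A time \<open>s\<close> before \<open>k\<close> is handled by growing
        forward to \<open>k\<close>, where \<open>late\<close> applies.\<close>
      have "B0 < N (y (max s k) v)" by (rule late[OF v]) simp
      also have "\<dots> \<le> C' * N (y s v)" using \<open>0 \<le> s\<close> by (intro C') auto
      finally show ?thesis by simp
    qed
    show ?thesis
    proof (cases "v = 0")
      case False
      define w where "w = inverse (norm v) *\<^sub>R v"
      have "w \<in> W" "norm w = 1" using \<open>v \<in> W\<close> W False by (auto simp: w_def subspace_scale)
      then have "N (y 0 w) \<le> C' * N (y s w)" using unit[of w] B0(2)[of w] by simp
      then have "inverse (norm v) * N (y 0 v) \<le> inverse (norm v) * (C' * N (y s v))"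
        by (simp add: w_def linear_scale[OF lin] is_norm_scaleR[OF N] mult.left_commute[of C'])
      then show ?thesis using False by (simp add: mult_le_cancel_left)
    qed (simp add: linear_0[OF lin] is_norm_zero[OF N])
  qed
  define D where "D = C * C'"
  have D: "1 \<le> D" using C C' mult_mono[of 1 C 1 C'] by (simp add: D_def)
  \<comment> \<open>On [0,s] the left endpoint of the maximum principle is absorbed into the right
    one by \<open>W_lower\<close>.\<close>
  have W_bound: "N (y t v) \<le> D * N (y s v)" if "v \<in> W" "0 \<le> t" "t \<le> s" for v s t
  proof -
    have "N (y s v) \<le> C' * N (y s v)" using mult_right_mono[OF C'(1) N_nonneg[of "y s v"]] by simp
    then have "C * max (N (y 0 v)) (N (y s v)) \<le> C * (C' * N (y s v))"
      using C W_lower[of v s] that by (intro mult_left_mono) auto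
    then show ?thesis using max_principle[of 0 t s v] that by (simp add: D_def)
  qed
  \<comment> \<open>A jump of \<open>crit_iterate\<close> may go either way, but
    \<open>W_bound\<close> carries its landing point forward to \<open>t + T'\<close> at the cost of
    \<open>D\<close>; \<open>m\<close> jumps outweigh that cost.\<close>
  obtain m :: nat where m: "\<theta> ^ m * D \<le> 1 / 2" "0 < m"
  proof -
    have "(\<lambda>m. \<theta> ^ m * D) \<longlonglongrightarrow> 0 * D"
      using \<theta> by (intro tendsto_intros LIMSEQ_power_zero) auto
    then have "\<forall>\<^sub>F m in sequentially. \<theta> ^ m * D < 1 / 2" by (rule order_tendstoD) simp
    then obtain m0 where "\<And>m. m0 \<le> m \<Longrightarrow> \<theta> ^ m * D < 1 / 2" unfolding eventually_sequentially by blast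
    then have "\<theta> ^ Suc m0 * D < 1 / 2" by (meson le_Suc_eq order_refl)
    then show thesis by (intro that[of "Suc m0"]) auto
  qed
  define T' where "T' = m * T"
  have T': "0 < T'" using m T by (simp add: T'_def)
  have half: "N (y t v) \<le> 1 / 2 * N (y (t + T') v)" if vt: "v \<in> W" "T' \<le> t" for v t
  proof -
    obtain u where u: "t - T' \<le> u" "u \<le> t + T'" "N (y t v) \<le> \<theta> ^ m * N (y u v)"
      using crit_iterate[of m t v] vt unfolding T'_def by auto
    have "\<theta> ^ m * N (y u v) \<le> \<theta> ^ m * (D * N (y (t + T') v))"
      using \<theta> u W_bound[of v u "t + T'"] that by (intro mult_left_mono) auto
    also have "\<dots> \<le> 1 / 2 * N (y (t + T') v)"
      using mult_right_mono[OF m(1) N_nonneg[of "y (t + T') v"]] by (simp add: mult.assoc)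
    finally show ?thesis using u by simp
  qed
  have halves: "N (y t v) \<le> (1 / 2) ^ j * N (y (t + j * T') v)" if "v \<in> W" "T' \<le> t" for v t and j :: nat
  proof (induction j)
    case (Suc j)
    have "(1 / 2) ^ j * N (y (t + j * T') v) \<le> (1 / 2) ^ j * (1 / 2 * N (y (t + j * T' + T') v))"
      using that T' by (intro mult_left_mono half) (auto intro: add_increasing2)
    with Suc have "N (y t v) \<le> (1 / 2) ^ j * (1 / 2 * N (y (t + j * T' + T') v))" by (rule order_trans)
    then show ?case by (simp add: algebra_simps)
  qed simp
  have W_decay: "N (y t v) \<le> 4 * D\<^sup>2 * exp (- (ln 2 / T') * (s - t)) * N (y s v)"
    if v: "v \<in> W" and ts: "0 \<le> t" "t \<le> s" for v s t
  proof -
    obtain j :: nat where j: "j * T' \<le> s - t"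
        "(1 / 2) ^ j \<le> inverse (1 / 2) * exp (- (- ln (1 / 2) / T') * (s - t))"
      using geometric_le_exp[of "1/2" T' "s - t"] T' ts by auto
    \<comment> \<open>\<open>halves\<close> is valid only from \<open>T'\<close> on, so one period
      is spent reaching \<open>t + T'\<close>, which forfeits one halving and gives the 2. Each end
      of the path uses \<open>W_bound\<close> once, hence \<open>D\<close> squared; the other 2
      comes from \<open>geometric_le_exp\<close>.\<close>
    have "N (y t v) \<le> 2 * D\<^sup>2 * (1 / 2) ^ j * N (y s v)"
    proof (cases j)
      case 0
      have "D * N (y s v) \<le> 2 * D\<^sup>2 * N (y s v)"
        using D N_nonneg by (intro mult_right_mono) (simp_all add: power2_eq_square)
      then show ?thesis using W_bound[OF v ts] 0 by simp
    next
      case (Suc i)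
      have le: "t + T' + i * T' \<le> s" using j Suc by (simp add: algebra_simps)
      have "0 \<le> i * T'" using T' by simp
      have "N (y t v) \<le> D * N (y (t + T') v)" using W_bound[OF v] ts T' by simp
      also have "\<dots> \<le> D * ((1 / 2) ^ i * N (y (t + T' + i * T') v))"
        using D ts v by (intro mult_left_mono halves) auto
      also have "\<dots> \<le> D * ((1 / 2) ^ i * (D * N (y s v)))"
        using D ts T' le v \<open>0 \<le> i * T'\<close> by (intro mult_left_mono W_bound) auto
      finally show ?thesis using Suc by (simp add: power2_eq_square mult_ac)
    qed
    also have "\<dots> \<le> 2 * D\<^sup>2 * (inverse (1 / 2) * exp (- (- ln (1 / 2) / T') * (s - t))) * N (y s v)"
      using j N_nonneg by (intro mult_right_mono mult_left_mono) auto
    finally show ?thesis by (simp add: ln_div)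
  qed
  define \<alpha> K where "\<alpha> = min (- ln \<theta> / T) (ln 2 / T')" and "K = max (C / \<theta>) (4 * D\<^sup>2)"
  have \<alpha>: "0 < \<alpha>" using \<theta> T T' by (simp add: \<alpha>_def divide_neg_pos)
  have "1 \<le> D\<^sup>2" using D by simp
  then have K: "1 \<le> K" by (simp add: K_def)
  have stable: "N (y t v) \<le> K * exp (- \<alpha> * (t - s)) * N (y s v)"
    if "v \<in> bounded_orbits" "0 \<le> s" "s \<le> t" for v s t
  proof -
    have "exp (- (- ln \<theta> / T) * (t - s)) \<le> exp (- \<alpha> * (t - s))"
      unfolding exp_le_cancel_iff using that by (intro mult_right_mono) (auto simp: \<alpha>_def)
    then have "C / \<theta> * exp (- (- ln \<theta> / T) * (t - s)) * N (y s v) \<le> K * exp (- \<alpha> * (t - s)) * N (y s v)"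
      using K N_nonneg by (intro mult_right_mono mult_mono) (auto simp: K_def)
    then show ?thesis using bounded_orbit_decay[OF that] by linarith
  qed
  have unstable: "N (y s v) \<le> K * exp (- \<alpha> * (t - s)) * N (y t v)"
    if "v \<in> W" "0 \<le> s" "s \<le> t" for v s t
  proof -
    have "exp (- (ln 2 / T') * (t - s)) \<le> exp (- \<alpha> * (t - s))"
      unfolding exp_le_cancel_iff using that by (intro mult_right_mono) (auto simp: \<alpha>_def)
    then have "4 * D\<^sup>2 * exp (- (ln 2 / T') * (t - s)) * N (y t v) \<le> K * exp (- \<alpha> * (t - s)) * N (y t v)"
      using K N_nonneg by (intro mult_right_mono mult_mono) (auto simp: K_def)
    then show ?thesis using W_decay[OF that] by linarith
  qed
  text \<open>The angle between the two subspaces stays bounded away from zero: after time \<open>S\<close> their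
    components differ in size by a large factor, while growth over time \<open>S\<close> is bounded.\<close>
  define S where "S = ln (K\<^sup>2 + K) / \<alpha>"
  have K2: "2 \<le> K\<^sup>2 + K" using K by (smt (verit) one_le_power)
  then have S: "0 < S" using \<alpha> by (simp add: S_def)
  \<comment> \<open>Since K^2 + K = K (K + 1), over time \<open>S\<close> the stable component
    shrinks and the unstable one grows by the factor K + 1.\<close>
  have "exp (- \<alpha> * S) = inverse (K\<^sup>2 + K)" using \<alpha> K2 by (simp add: S_def exp_minus)
  moreover have "inverse (K\<^sup>2 + K) = inverse K * inverse (K + 1)"
    by (simp add: power2_eq_square distrib_left flip: inverse_mult_distrib)
  ultimately have KS: "K * exp (- \<alpha> * S) = inverse (K + 1)" using K by simp
  obtain CS where CS: "1 \<le> CS" "\<And>v s t. 0 \<le> s \<Longrightarrow> s \<le> t \<Longrightarrow> t \<le> s + S \<Longrightarrow> N (y t v) \<le> CS * N (y s v)"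
    using bounded_growth[OF S] by (meson atLeastAtMost_iff)
  define E where "E = CS + K + 1"
  have proj: "N (y t (Q v)) \<le> E * N (y t v)" if "0 \<le> t" for t v
  proof -
    have sum: "y r v = y r (Q v) + y r (v - Q v)" for r
      by (simp add: linear_add[OF lin, symmetric])
    have 1: "N (y (t + S) (Q v)) \<le> N (y t (Q v))"
    proof -
      have "N (y (t + S) (Q v)) \<le> inverse (K + 1) * N (y t (Q v))"
        using stable[OF Q(2), of t "t + S"] that S KS by simp
      also have "\<dots> \<le> 1 * N (y t (Q v))"
        using K N_nonneg by (intro mult_right_mono) (auto simp: field_simps)
      finally show ?thesis by simp
    qed
    have "N (y t (v - Q v)) \<le> inverse (K + 1) * N (y (t + S) (v - Q v))"
      using unstable[OF Q(4), of t "t + S"] that S KS by simp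
    then have 2: "(K + 1) * N (y t (v - Q v)) \<le> N (y (t + S) (v - Q v))"
      using K by (simp add: field_simps)
    have 3: "N (y (t + S) (v - Q v)) \<le> N (y (t + S) v) + N (y (t + S) (Q v))"
      using is_norm_triangle_sub[OF N, of "y (t + S) v" "y (t + S) (Q v)"]
      by (simp add: linear_diff[OF lin])
    have 4: "N (y (t + S) v) \<le> CS * N (y t v)" using that S by (intro CS) auto
    have "N (y t (Q v)) \<le> N (y t v) + N (y t (v - Q v))"
      using is_norm_triangle_sub[OF N, of "y t v" "y t (v - Q v)"] sum[of t] by simp
    then have "(K + 1) * N (y t (Q v)) \<le> (K + 1) * N (y t v) + (K + 1) * N (y t (v - Q v))"
      using K by (simp flip: distrib_left)
    \<comment> \<open>Chaining 2, 3, 4 and 1 brings back one copy of \<open>N (y t (Q v))\<close>;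
      moving it to the left turns K + 1 into K and leaves exactly \<open>E\<close> on the
      right.\<close>
    then have "K * N (y t (Q v)) \<le> E * N (y t v)"
      using 1 2 3 4 unfolding E_def by (simp add: algebra_simps)
    moreover have "N (y t (Q v)) \<le> K * N (y t (Q v))"
      using mult_right_mono[OF K N_nonneg[of "y t (Q v)"]] by simp
    ultimately show ?thesis by linarith
  qed
  have E: "1 \<le> E" using CS K by (simp add: E_def)
  have proj': "N (y t (v - Q v)) \<le> (E + 1) * N (y t v)" if "0 \<le> t" for t v
    using is_norm_triangle_sub[OF N, of "y t v" "y t (Q v)"] proj[OF that, of v]
    by (simp add: linear_diff[OF lin] algebra_simps)
  show ?thesis
    unfolding exp_dichotomy_def
  proof (intro exI conjI allI ballI impI)
    show "linear Q" "\<And>v. Q (Q v) = Q v" by fact+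
    show "0 < \<alpha>" by fact
    \<comment> \<open>\<open>E + 1\<close> bounds either component by the full vector at the time
      from which it is estimated.\<close>
    show "1 \<le> K * (E + 1)" using K E mult_mono[of 1 K 1 "E + 1"] by simp
    fix v and s t :: real
    assume st: "s \<in> {0..}" "t \<in> {0..}" "s \<le> t"
    have "N (y t (Q v)) \<le> K * exp (- \<alpha> * (t - s)) * N (y s (Q v))"
      using st by (intro stable Q) auto
    also have "\<dots> \<le> K * exp (- \<alpha> * (t - s)) * ((E + 1) * N (y s v))"
      using proj[of s v] N_nonneg[of "y s v"] st K by (intro mult_left_mono) (auto simp: algebra_simps)
    finally show "N (y t (Q v)) \<le> K * (E + 1) * exp (- \<alpha> * (t - s)) * N (y s v)"
      by (simp add: mult_ac)
    have "N (y s (v - Q v)) \<le> K * exp (- \<alpha> * (t - s)) * N (y t (v - Q v))"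
      using st by (intro unstable Q) auto
    also have "\<dots> \<le> K * exp (- \<alpha> * (t - s)) * ((E + 1) * N (y t v))"
      using proj'[of t v] st K by (intro mult_left_mono) auto
    finally show "N (y s (v - Q v)) \<le> K * (E + 1) * exp (- \<alpha> * (t - s)) * N (y t v)"
      by (simp add: mult_ac)
  qed
qed

text \<open>On the whole line the jumps never run out of room, so any bound \<open>B\<close>
  improves to \<theta>^k B for every k.\<close>

lemma noncritical_bounded_eq_0:
  assumes N: "is_norm N" and crit: "noncritical N y" and bdd: "\<And>t. N (y t v) \<le> B"
  shows "N (y t v) = 0"
proof -
  obtain T \<theta> where \<theta>: "0 < \<theta>" "\<theta> < 1" and c: "\<And>t. \<exists>u. N (y t v) \<le> \<theta> * N (y u v)"
    using crit unfolding noncritical_def by blast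
  have "N (y t v) \<le> \<theta> ^ k * B" for k t
  proof (induction k arbitrary: t)
    case (Suc k)
    obtain u where "N (y t v) \<le> \<theta> * N (y u v)" using c by blast
    also have "\<dots> \<le> \<theta> * (\<theta> ^ k * B)" using \<theta> Suc by (intro mult_left_mono) auto
    finally show ?case by simp
  qed (simp add: bdd)
  moreover have "(\<lambda>k. \<theta> ^ k * B) \<longlonglongrightarrow> 0 * B"
    using \<theta> by (intro tendsto_intros LIMSEQ_power_zero) auto
  ultimately have "N (y t v) \<le> 0" by (intro LIMSEQ_le_const) auto
  then show ?thesis using is_norm_nonneg[OF N, of "y t v"] by linarith
qed

section \<open>Reparametrization by the growth rate\<close>

locale growth_group =
  fixes J :: "real set" and h :: "real \<Rightarrow> real"
  assumes growth_rate: "growth_rate J h"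
    and upward: "t \<in> J \<Longrightarrow> t \<le> u \<Longrightarrow> u \<in> J"
begin

definition \<phi> :: "real \<Rightarrow> real" where "\<phi> \<tau> = inv_into J h (exp \<tau>)"

lemma strict_mono_h: "strict_mono_on J h"
  and image_h: "h ` J = {0<..}"
  using growth_rate by (auto simp: growth_rate_def homeomorphism_def)

lemma inj_h: "inj_on h J"
  using strict_mono_h strict_mono_on_imp_inj_on by blast

lemma phi_in [simp]: "\<phi> \<tau> \<in> J"
  unfolding \<phi>_def by (rule inv_into_into) (simp add: image_h)

lemma h_phi [simp]: "h (\<phi> \<tau>) = exp \<tau>"
  unfolding \<phi>_def by (rule f_inv_into_f) (simp add: image_h)

lemma phi_ln_h: "t \<in> J \<Longrightarrow> \<phi> (ln (h t)) = t"
  using image_h inv_into_f_f[OF inj_h] by (metis \<phi>_def exp_ln greaterThan_iff imageI)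

lemma phi_cases: assumes "t \<in> J" obtains \<tau> where "t = \<phi> \<tau>"
  using phi_ln_h[OF assms] that by metis

lemma phi_le_iff [simp]: "\<phi> \<sigma> \<le> \<phi> \<tau> \<longleftrightarrow> \<sigma> \<le> \<tau>"
  using strict_mono_on_less_eq[OF strict_mono_h phi_in phi_in, of \<sigma> \<tau>] by simp

lemma phi_less_iff [simp]: "\<phi> \<sigma> < \<phi> \<tau> \<longleftrightarrow> \<sigma> < \<tau>"
  by (simp add: not_le[symmetric])

lemma gunit_phi: "gunit J h = \<phi> 0"
  by (simp add: gunit_def \<phi>_def)

lemma gmult_phi [simp]: "gmult J h (\<phi> \<sigma>) (\<phi> \<tau>) = \<phi> (\<sigma> + \<tau>)"
  by (simp add: gmult_def exp_add[symmetric]) (simp add: \<phi>_def)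

lemma ginv_phi [simp]: "ginv J h (\<phi> \<tau>) = \<phi> (- \<tau>)"
  by (simp add: ginv_def exp_minus inverse_eq_divide[symmetric]) (simp add: \<phi>_def exp_minus)

lemma gabs_phi [simp]: "gabs J h (\<phi> \<tau>) = \<phi> \<bar>\<tau>\<bar>"
  by (auto simp: gabs_def gunit_phi)

lemma continuous_phi: "continuous_on UNIV \<phi>"
proof -
  obtain g where g: "homeomorphism J {0<..} h g" using growth_rate by (auto simp: growth_rate_def)
  have "g (h (\<phi> \<tau>)) = \<phi> \<tau>" for \<tau>
    by (rule homeomorphism_apply1[OF g phi_in])
  moreover have "continuous_on UNIV (\<lambda>\<tau>. g (exp \<tau>))"
    by (rule continuous_on_compose2[OF homeomorphism_cont2[OF g]]) (auto intro: continuous_intros)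
  ultimately show ?thesis by simp
qed

end

lemma exp_powr_eq: "exp (a::real) powr b = exp (b * a)"
  by (simp add: powr_def)

text \<open>The differential equation enters below only through invertibility and continuity of
  \<open>F\<close> and the description of solutions as its orbits.\<close>

locale reparametrized_system = growth_group J h for J h +
  fixes N :: "real^'n \<Rightarrow> real" and A F :: "real \<Rightarrow> real^'n^'n"
  assumes N: "is_norm N"
    and fundamental: "fundamental_matrix J A F"
    and transition: "transition_matrix J A = (\<lambda>t s. F t ** matrix_inv (F s))"
    and contF: "continuous_on J F"
    and solution: "is_solution J A x \<longleftrightarrow> (\<exists>v. \<forall>t\<in>J. x t = F t *v v)"
begin

definition y :: "real \<Rightarrow> real^'n \<Rightarrow> real^'n" where "y \<tau> v = F (\<phi> \<tau>) *v v"

lemma lin: "linear (y \<tau>)"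
  unfolding y_def[abs_def] by simp

lemma invertible_F: "t \<in> J \<Longrightarrow> invertible (F t)"
  using fundamental by (simp add: fundamental_matrix_def)

lemma inv_F: "t \<in> J \<Longrightarrow> matrix_inv (F t) ** F t = mat 1" "t \<in> J \<Longrightarrow> F t ** matrix_inv (F t) = mat 1"
proof -
  assume "t \<in> J"
  then have "\<exists>A'. F t ** A' = mat 1 \<and> A' ** F t = mat 1"
    using invertible_F unfolding invertible_def by blast
  from someI_ex[OF this] show "matrix_inv (F t) ** F t = mat 1" "F t ** matrix_inv (F t) = mat 1"
    unfolding matrix_inv_def by simp_all
qed

lemma inj_y: "inj (y \<tau>)"
  unfolding y_def[abs_def] by (intro inj_matrix_vector_mult invertible_F) simp

lemma cont: "continuous_on S (\<lambda>\<tau>. y \<tau> v)"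
proof -
  have "continuous_on UNIV (\<lambda>\<tau>. F (\<phi> \<tau>))"
    by (rule continuous_on_compose2[OF contF continuous_phi]) auto
  then have "continuous_on UNIV (\<lambda>\<tau>. F (\<phi> \<tau>) *v v)"
    by (intro bounded_bilinear.continuous_on[OF bounded_bilinear_matrix_vector_mult] continuous_intros)
  then show ?thesis unfolding y_def using continuous_on_subset by blast
qed

lemma Ball_J: "(\<forall>t\<in>J. P t) \<longleftrightarrow> (\<forall>\<tau>. P (\<phi> \<tau>))"
  using phi_ln_h phi_in by metis

lemma solution_y: "is_solution J A x \<longleftrightarrow> (\<exists>v. \<forall>\<tau>. x (\<phi> \<tau>) = y \<tau> v)"
  unfolding solution y_def Ball_J ..

lemma solution_cases:
  assumes "is_solution J A x"
  obtains v where "\<And>\<tau>. x (\<phi> \<tau>) = y \<tau> v"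
  using assms unfolding solution_y by blast

lemma solution_F: "is_solution J A (\<lambda>t. F t *v v)"
  unfolding solution by blast

section \<open>Translation of the properties into the additive flow\<close>

lemma expansive_iff: "expansive N J h A J \<longleftrightarrow> exp_expansive N y"
proof
  assume "expansive N J h A J"
  then obtain L \<beta> where L: "0 < L" "0 < \<beta>"
    and ex: "\<forall>x. is_solution J A x \<longrightarrow> (\<forall>a b. {a..b} \<subseteq> J \<longrightarrow> (\<forall>t\<in>{a..b}.
      N (x t) \<le> L * (h (gmult J h t (ginv J h a)) powr (-\<beta>) * N (x a)
                   + h (gmult J h b (ginv J h t)) powr (-\<beta>) * N (x b))))"
    unfolding expansive_def by (elim exE conjE)
  have "N (y t v) \<le> L * (exp (-\<beta> * (t - a)) * N (y a v) + exp (-\<beta> * (b - t)) * N (y b v))"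
    if "a \<le> t" "t \<le> b" for v a t b
  proof -
    have "{\<phi> a..\<phi> b} \<subseteq> J" using upward[OF phi_in] by auto
    from ex[rule_format, OF solution_F this, of "\<phi> t" v] that show ?thesis
      by (simp add: exp_powr_eq y_def)
  qed
  then show "exp_expansive N y" unfolding exp_expansive_def using L by blast
next
  assume "exp_expansive N y"
  then obtain L \<beta> where L: "0 < L" "0 < \<beta>"
    and ex: "\<And>v a t b. a \<le> t \<Longrightarrow> t \<le> b \<Longrightarrow>
      N (y t v) \<le> L * (exp (-\<beta> * (t - a)) * N (y a v) + exp (-\<beta> * (b - t)) * N (y b v))"
    unfolding exp_expansive_def by blast
  have "N (x t) \<le> L * (h (gmult J h t (ginv J h a)) powr (-\<beta>) * N (x a)
                   + h (gmult J h b (ginv J h t)) powr (-\<beta>) * N (x b))"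
    if x: "is_solution J A x" and ab: "{a..b} \<subseteq> J" and t: "t \<in> {a..b}" for x a b t
  proof -
    obtain v where v: "\<And>\<tau>. x (\<phi> \<tau>) = y \<tau> v" using solution_cases[OF x] by blast
    have "a \<in> J" "b \<in> J" "t \<in> J" using ab t by auto
    then obtain a' b' t' where "a = \<phi> a'" "b = \<phi> b'" "t = \<phi> t'" by (metis phi_cases)
    then show ?thesis using ex[of a' t' b' v] t by (simp add: v exp_powr_eq)
  qed
  then show "expansive N J h A J" unfolding expansive_def using L by blast
qed

text \<open>\<phi> maps a compact additive window onto the window of the group, and continuity makes
  the supremum over it a maximum.\<close>

lemma le_SUP_iff:
  assumes x: "\<And>\<tau>. x (\<phi> \<tau>) = y \<tau> v" and "0 < \<theta>" "0 \<le> c"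
  shows "N (y \<tau> v) \<le> \<theta> * (SUP u\<in>{u \<in> J. gabs J h (gmult J h u (ginv J h (\<phi> \<tau>))) \<le> \<phi> c}. N (x u)) \<longleftrightarrow>
    (\<exists>u\<in>{\<tau> - c..\<tau> + c}. N (y \<tau> v) \<le> \<theta> * N (y u v))"
proof -
  have "{u \<in> J. gabs J h (gmult J h u (ginv J h (\<phi> \<tau>))) \<le> \<phi> c} = \<phi> ` {\<tau> - c..\<tau> + c}"
    by (auto simp: abs_le_iff elim!: phi_cases)
  then have eq: "(SUP u\<in>{u \<in> J. gabs J h (gmult J h u (ginv J h (\<phi> \<tau>))) \<le> \<phi> c}. N (x u)) =
      (SUP u\<in>{\<tau> - c..\<tau> + c}. N (y u v))"
    by (simp add: image_image x)
  have "continuous_on {\<tau> - c..\<tau> + c} (\<lambda>u. N (y u v))"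
    by (intro is_norm_continuous_compose[OF N] cont)
  then obtain u0 where u0: "u0 \<in> {\<tau> - c..\<tau> + c}" "\<And>u. u \<in> {\<tau> - c..\<tau> + c} \<Longrightarrow> N (y u v) \<le> N (y u0 v)"
    using continuous_attains_sup[of "{\<tau> - c..\<tau> + c}" "\<lambda>u. N (y u v)"] \<open>0 \<le> c\<close> by auto
  then have "(SUP u\<in>{\<tau> - c..\<tau> + c}. N (y u v)) = N (y u0 v)"
    by (intro cSup_eq_maximum) auto
  then show ?thesis
    unfolding eq using u0 \<open>0 < \<theta>\<close> by (smt (verit, best) mult_left_mono)
qed

lemma noncritical_iff: "uniformly_noncritical N J h A J \<longleftrightarrow> noncritical N y"
proof
  assume "uniformly_noncritical N J h A J"
  then obtain T \<theta> where T: "gunit J h < T" and \<theta>: "0 < \<theta>" "\<theta> < 1"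
    and nc: "\<And>x t. is_solution J A x \<Longrightarrow> t \<in> J \<Longrightarrow> {gmult J h t (ginv J h T)..gmult J h t T} \<subseteq> J \<Longrightarrow>
      N (x t) \<le> \<theta> * (SUP u\<in>{u\<in>J. gabs J h (gmult J h u (ginv J h t)) \<le> T}. N (x u))"
    unfolding uniformly_noncritical_def by blast
  \<comment> \<open>\<open>T\<close> is a priori just a real number above the unit; \<open>J\<close>
    being a ray, it is a value of \<phi>.\<close>
  have "T \<in> J" using upward[of "\<phi> 0" T] T by (simp add: gunit_phi)
  then obtain c where c: "T = \<phi> c" by (rule phi_cases)
  then have "0 < c" using T by (simp add: gunit_phi)
  have "\<exists>u\<in>{\<tau> - c..\<tau> + c}. N (y \<tau> v) \<le> \<theta> * N (y u v)" for v \<tau>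
  proof -
    have "{\<phi> (\<tau> - c)..\<phi> (\<tau> + c)} \<subseteq> J" using upward[OF phi_in] by auto
    then have "N (y \<tau> v) \<le> \<theta> * (SUP u\<in>{u \<in> J. gabs J h (gmult J h u (ginv J h (\<phi> \<tau>))) \<le> \<phi> c}. N (F u *v v))"
      using nc[OF solution_F, of "\<phi> \<tau>" v] by (simp add: c y_def)
    then show ?thesis
      using le_SUP_iff[of "\<lambda>t. F t *v v" v \<theta> c \<tau>] \<theta> \<open>0 < c\<close> by (simp add: y_def)
  qed
  then show "noncritical N y" unfolding noncritical_def using \<theta> \<open>0 < c\<close> by blast
next
  assume "noncritical N y"
  then obtain c \<theta> where c: "0 < c" and \<theta>: "0 < \<theta>" "\<theta> < 1"
    and nc: "\<And>v \<tau>. \<exists>u\<in>{\<tau> - c..\<tau> + c}. N (y \<tau> v) \<le> \<theta> * N (y u v)"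
    unfolding noncritical_def by blast
  have "N (x t) \<le> \<theta> * (SUP u\<in>{u\<in>J. gabs J h (gmult J h u (ginv J h t)) \<le> \<phi> c}. N (x u))"
    if x: "is_solution J A x" and "t \<in> J" for x t
  proof -
    obtain v where v: "\<And>\<tau>. x (\<phi> \<tau>) = y \<tau> v" using solution_cases[OF x] by blast
    obtain \<tau> where "t = \<phi> \<tau>" using phi_cases[OF \<open>t \<in> J\<close>] by blast
    then show ?thesis using le_SUP_iff[of x v \<theta> c \<tau>] v nc \<theta> c by simp
  qed
  moreover have "gunit J h < \<phi> c" using c by (simp add: gunit_phi)
  ultimately show "uniformly_noncritical N J h A J"
    unfolding uniformly_noncritical_def using \<theta> by blast
qed

lemma bounded_growth_y:
  assumes "uniform_bounded_growth N J h A {gunit J h..}" "0 < S"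
  shows "\<exists>C\<ge>1. \<forall>v. \<forall>s\<ge>0. \<forall>t\<in>{s..s + S}. N (y t v) \<le> C * N (y s v)"
proof -
  have "gunit J h < \<phi> S" using \<open>0 < S\<close> by (simp add: gunit_phi)
  then obtain C where "1 \<le> C" and C: "\<And>x s t. is_solution J A x \<Longrightarrow> s \<in> {gunit J h..} \<Longrightarrow>
      t \<in> {s..gmult J h s (\<phi> S)} \<inter> {gunit J h..} \<Longrightarrow> N (x t) \<le> C * N (x s)"
    using assms(1) unfolding uniform_bounded_growth_def by blast
  have "N (y t v) \<le> C * N (y s v)" if "0 \<le> s" "t \<in> {s..s + S}" for v s t
    using C[OF solution_F, of "\<phi> s" "\<phi> t" v] that by (simp add: gunit_phi y_def)
  then show ?thesis using \<open>1 \<le> C\<close> by blast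
qed

text \<open>After reflection of time, decay to the left of the unit is bounded growth on the right
  half-line, in the form that \<open>half_line_exp_dichotomy\<close> expects.\<close>

lemma bounded_decay_y:
  assumes "uniform_bounded_decay N J h A (J \<inter> {..gunit J h})" "0 < S"
  shows "\<exists>C\<ge>1. \<forall>v. \<forall>s\<ge>0. \<forall>t\<in>{s..s + S}. N (y (- t) v) \<le> C * N (y (- s) v)"
proof -
  have "gunit J h < \<phi> S" using \<open>0 < S\<close> by (simp add: gunit_phi)
  then obtain C where "1 \<le> C" and C: "\<And>x s t. is_solution J A x \<Longrightarrow> s \<in> J \<inter> {..gunit J h} \<Longrightarrow>
      t \<in> {gmult J h s (ginv J h (\<phi> S))..s} \<inter> (J \<inter> {..gunit J h}) \<Longrightarrow> N (x t) \<le> C * N (x s)"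
    using assms(1) unfolding uniform_bounded_decay_def by blast
  have "N (y (- t) v) \<le> C * N (y (- s) v)" if "0 \<le> s" "t \<in> {s..s + S}" for v s t
    using C[OF solution_F, of "\<phi> (- s)" "\<phi> (- t)" v] that by (simp add: gunit_phi y_def)
  then show ?thesis using \<open>1 \<le> C\<close> by blast
qed

text \<open>Since \<open>F s\<close> is invertible, \<open>F s *v v\<close> runs through all
  vectors, so an operator norm can be tested on such vectors.\<close>

lemma dichotomy_bound_iff:
  assumes Q: "\<And>v. F t *v Q v = X *v (F s *v v)" and s: "s \<in> J"
  shows "matrix_norm N X \<le> B \<longleftrightarrow> (\<forall>v. N (F t *v Q v) \<le> B * N (F s *v v))"
  unfolding matrix_norm_le_iff[OF N] Q
  by (metis inv_F(2)[OF s] matrix_vector_mul_assoc matrix_vector_mul_lid)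

text \<open>Invariance conjugates all projectors to a single matrix \<open>q\<close>. It is read off
  at time 0, whence the assumption on \<open>S\<close>; conversely \<open>q\<close> is transported
  to P(t) = F(t) q F(t)^(-1).\<close>

lemma dichotomy_iff:
  assumes "0 \<in> S"
  shows "uniform_dichotomy N J h A (\<phi> ` S) \<longleftrightarrow> exp_dichotomy N y S"
proof -
  have rate: "K * (h (\<phi> t) / h (\<phi> s)) powr (-\<alpha>) = K * exp (-\<alpha> * (t - s))" for K \<alpha> t s
    by (simp add: exp_diff[symmetric] exp_powr_eq)
  let ?F' = "\<lambda>\<tau>. matrix_inv (F (\<phi> \<tau>))"
  have inv [simp]: "?F' \<tau> ** F (\<phi> \<tau>) = mat 1" "F (\<phi> \<tau>) ** ?F' \<tau> = mat 1" for \<tau>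
    by (simp_all add: inv_F)
  \<comment> \<open>With products associated to the left, an inverse pair must also cancel behind a
    prefix \<open>M\<close>.\<close>
  have inv_assoc [simp]: "M ** ?F' \<tau> ** F (\<phi> \<tau>) = M" "M ** F (\<phi> \<tau>) ** ?F' \<tau> = M" for M \<tau>
    by (simp_all flip: matrix_mul_assoc)
  have bounds: "(matrix_norm N (transition_matrix J A (\<phi> t) (\<phi> s) ** P) \<le> B \<longleftrightarrow>
        (\<forall>v. N (y t (q *v v)) \<le> B * N (y s v)))
      \<and> (matrix_norm N (transition_matrix J A (\<phi> t) (\<phi> s) ** (mat 1 - P)) \<le> B \<longleftrightarrow>
        (\<forall>v. N (y t (v - q *v v)) \<le> B * N (y s v)))"
    if P: "P ** F (\<phi> s) = F (\<phi> s) ** q" for t s P q B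
  proof
    have *: "F (\<phi> t) ** ?F' s ** P ** F (\<phi> s) = F (\<phi> t) ** q"
      by (metis P inv_assoc(1) matrix_mul_assoc)
    show "matrix_norm N (transition_matrix J A (\<phi> t) (\<phi> s) ** P) \<le> B \<longleftrightarrow>
        (\<forall>v. N (y t (q *v v)) \<le> B * N (y s v))"
      unfolding y_def
      by (rule dichotomy_bound_iff) (simp_all add: transition matrix_vector_mul_assoc *)
    show "matrix_norm N (transition_matrix J A (\<phi> t) (\<phi> s) ** (mat 1 - P)) \<le> B \<longleftrightarrow>
        (\<forall>v. N (y t (v - q *v v)) \<le> B * N (y s v))"
      unfolding y_def
    proof (rule dichotomy_bound_iff)
      show "F (\<phi> t) *v (v - q *v v) = (transition_matrix J A (\<phi> t) (\<phi> s) ** (mat 1 - P)) *v (F (\<phi> s) *v v)" for v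
        by (simp add: transition matrix_vector_mul_assoc *
            bounded_bilinear.diff_left[OF bounded_bilinear_matrix_matrix_mult]
            bounded_bilinear.diff_right[OF bounded_bilinear_matrix_matrix_mult]
            bounded_bilinear.diff_left[OF bounded_bilinear_matrix_vector_mult]
            bounded_bilinear.diff_right[OF bounded_bilinear_matrix_vector_mult])
    qed simp
  qed
  show ?thesis
  proof
    assume "uniform_dichotomy N J h A (\<phi> ` S)"
    then obtain P K \<alpha> where K: "1 \<le> K" "0 < \<alpha>"
      and idem: "\<forall>t\<in>S. P (\<phi> t) ** P (\<phi> t) = P (\<phi> t)"
      and comm: "\<forall>t\<in>S. \<forall>s\<in>S. P (\<phi> t) ** transition_matrix J A (\<phi> t) (\<phi> s) =
          transition_matrix J A (\<phi> t) (\<phi> s) ** P (\<phi> s)"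
      and b1: "\<forall>t\<in>S. \<forall>s\<in>S. s \<le> t \<longrightarrow>
          matrix_norm N (transition_matrix J A (\<phi> t) (\<phi> s) ** P (\<phi> s)) \<le> K * exp (-\<alpha> * (t - s))"
      and b2: "\<forall>t\<in>S. \<forall>s\<in>S. t \<le> s \<longrightarrow>
          matrix_norm N (transition_matrix J A (\<phi> t) (\<phi> s) ** (mat 1 - P (\<phi> s))) \<le> K * exp (-\<alpha> * (s - t))"
      unfolding uniform_dichotomy_def ball_simps rate phi_le_iff by (elim exE conjE)
    define q where "q = ?F' 0 ** P (\<phi> 0) ** F (\<phi> 0)"
    have q: "P (\<phi> s) ** F (\<phi> s) = F (\<phi> s) ** q" if "s \<in> S" for s
    proof -
      have "F (\<phi> s) ** q = (F (\<phi> s) ** ?F' 0 ** P (\<phi> 0)) ** F (\<phi> 0)" by (simp add: q_def matrix_mul_assoc)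
      also have "\<dots> = (P (\<phi> s) ** (F (\<phi> s) ** ?F' 0)) ** F (\<phi> 0)"
        using comm[rule_format, OF that assms] by (simp add: transition)
      finally show ?thesis by (simp add: matrix_mul_assoc)
    qed
    have "q ** q = ?F' 0 ** (P (\<phi> 0) ** P (\<phi> 0)) ** F (\<phi> 0)"
      unfolding q_def by (simp add: matrix_mul_assoc)
    then have "q ** q = q" by (simp add: idem[rule_format, OF assms] q_def)
    then have "q *v (q *v v) = q *v v" for v by (simp add: matrix_vector_mul_assoc)
    moreover have "N (y t (q *v v)) \<le> K * exp (-\<alpha> * (t - s)) * N (y s v)
        \<and> N (y s (v - q *v v)) \<le> K * exp (-\<alpha> * (t - s)) * N (y t v)"
      if "s \<in> S" "t \<in> S" "s \<le> t" for v s t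
      using bounds[OF q, of s] bounds[OF q, of t] b1[rule_format, of t s] b2[rule_format, of s t] that by blast
    ultimately show "exp_dichotomy N y S"
      unfolding exp_dichotomy_def using K
      by (intro exI[of _ "(*v) q"] exI[of _ K] exI[of _ \<alpha>]) (simp add: matrix_vector_mul_linear)
  next
    assume "exp_dichotomy N y S"
    then obtain Q K \<alpha> where Q: "linear Q" "\<And>v. Q (Q v) = Q v" and K: "1 \<le> K" "0 < \<alpha>"
      and b: "\<And>v s t. s \<in> S \<Longrightarrow> t \<in> S \<Longrightarrow> s \<le> t \<Longrightarrow> N (y t (Q v)) \<le> K * exp (-\<alpha> * (t - s)) * N (y s v)"
        "\<And>v s t. s \<in> S \<Longrightarrow> t \<in> S \<Longrightarrow> s \<le> t \<Longrightarrow> N (y s (v - Q v)) \<le> K * exp (-\<alpha> * (t - s)) * N (y t v)"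
      unfolding exp_dichotomy_def by blast
    define q where "q = matrix Q"
    have Qq: "Q v = q *v v" for v using Q(1) by (simp add: q_def matrix_works)
    have qq: "q ** q = q"
      using Q(2) by (simp add: Qq matrix_eq flip: matrix_vector_mul_assoc)
    define P where "P t = F t ** q ** matrix_inv (F t)" for t
    have q: "P (\<phi> s) ** F (\<phi> s) = F (\<phi> s) ** q" for s by (simp add: P_def)
    have "P (\<phi> t) ** P (\<phi> t) = F (\<phi> t) ** (q ** q) ** ?F' t" for t
      unfolding P_def by (simp add: matrix_mul_assoc)
    then have idem: "P (\<phi> t) ** P (\<phi> t) = P (\<phi> t)" for t by (simp add: qq P_def)
    have comm: "P (\<phi> t) ** transition_matrix J A (\<phi> t) (\<phi> s) =
          transition_matrix J A (\<phi> t) (\<phi> s) ** P (\<phi> s)" for t s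
      unfolding P_def transition by (simp add: matrix_mul_assoc)
    have "matrix_norm N (transition_matrix J A (\<phi> t) (\<phi> s) ** P (\<phi> s)) \<le> K * exp (-\<alpha> * (t - s))"
      if "s \<in> S" "t \<in> S" "s \<le> t" for s t
      using bounds[OF q, of t s] b(1)[of s t] that by (simp add: Qq)
    moreover have "matrix_norm N (transition_matrix J A (\<phi> t) (\<phi> s) ** (mat 1 - P (\<phi> s))) \<le> K * exp (-\<alpha> * (s - t))"
      if "s \<in> S" "t \<in> S" "t \<le> s" for s t
      using bounds[OF q, of t s] b(2)[of t s] that by (simp add: Qq)
    ultimately show "uniform_dichotomy N J h A (\<phi> ` S)"
      unfolding uniform_dichotomy_def ball_simps rate phi_le_iff using K idem comm
      by (intro exI[of _ P] exI[of _ K] exI[of _ \<alpha>] conjI ballI impI) blast+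
  qed
qed

lemma nontrivial_bounded_iff:
  "has_nontrivial_bounded_solution N J A \<longleftrightarrow> (\<exists>v. v \<noteq> 0 \<and> (\<exists>B. \<forall>\<tau>. N (y \<tau> v) \<le> B))"
proof
  assume "has_nontrivial_bounded_solution N J A"
  then obtain x B t where x: "is_solution J A x" "t \<in> J" "x t \<noteq> 0" "\<And>t. t \<in> J \<Longrightarrow> N (x t) \<le> B"
    unfolding has_nontrivial_bounded_solution_def by blast
  obtain v where v: "\<And>\<tau>. x (\<phi> \<tau>) = y \<tau> v" using solution_cases[OF x(1)] by blast
  obtain \<tau> where "t = \<phi> \<tau>" using phi_cases[OF x(2)] by blast
  then have "v \<noteq> 0" using x(3) v linear_0[OF lin] by auto
  moreover have "N (y \<tau> v) \<le> B" for \<tau> using x(4)[of "\<phi> \<tau>"] by (simp add: v)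
  ultimately show "\<exists>v. v \<noteq> 0 \<and> (\<exists>B. \<forall>\<tau>. N (y \<tau> v) \<le> B)" by blast
next
  assume "\<exists>v. v \<noteq> 0 \<and> (\<exists>B. \<forall>\<tau>. N (y \<tau> v) \<le> B)"
  then obtain v B where "v \<noteq> 0" and B: "\<And>\<tau>. N (y \<tau> v) \<le> B" by blast
  have "y 0 v \<noteq> 0" using \<open>v \<noteq> 0\<close> inj_y[of 0] linear_injective_0[OF lin[of 0]] by blast
  moreover have "N (F t *v v) \<le> B" if "t \<in> J" for t
    using phi_cases[OF that] B by (metis y_def)
  ultimately show "has_nontrivial_bounded_solution N J A"
    unfolding has_nontrivial_bounded_solution_def y_def using solution_F[of v] phi_in by blast
qed

lemma image_half_lines:
  "{gunit J h..} = \<phi> ` {0..}" "J \<inter> {..gunit J h} = \<phi> ` {..0}"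
proof -
  have image: "X = \<phi> ` Y" if "X \<subseteq> J" "\<And>\<tau>. \<phi> \<tau> \<in> X \<longleftrightarrow> \<tau> \<in> Y" for X Y
  proof (intro equalityI subsetI)
    fix t assume "t \<in> X"
    then obtain \<tau> where "t = \<phi> \<tau>" using \<open>X \<subseteq> J\<close> phi_cases by (metis subsetD)
    then show "t \<in> \<phi> ` Y" using \<open>t \<in> X\<close> that(2) by simp
  qed (use that(2) in auto)
  show "{gunit J h..} = \<phi> ` {0..}"
    using upward[OF phi_in, of 0] by (intro image) (auto simp: gunit_phi)
  show "J \<inter> {..gunit J h} = \<phi> ` {..0}"
    by (intro image) (auto simp: gunit_phi)
qed

end

theorem theorem1:
  fixes N :: "real^'n \<Rightarrow> real"
    and a0 :: ereal
    and J :: "real set"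
    and h :: "real \<Rightarrow> real"
    and A :: "real \<Rightarrow> real^'n^'n"
  assumes "is_norm N"
    and "a0 \<noteq> \<infinity>"
    and "J = {t. a0 < ereal t}"
    and "growth_rate J h"
    and "continuous_on J A"
  shows
    "let e = gunit J h;
         stmt_i = uniform_dichotomy N J h A {e..} \<and> uniform_dichotomy N J h A (J \<inter> {..e})
                    \<and> \<not> has_nontrivial_bounded_solution N J A;
         stmt_ii = expansive N J h A J;
         stmt_iii = uniformly_noncritical N J h A J
     in (uniform_bounded_growth N J h A {e..} \<and> uniform_bounded_decay N J h A (J \<inter> {..e})
           \<longrightarrow> (stmt_i \<longleftrightarrow> stmt_ii) \<and> (stmt_ii \<longleftrightarrow> stmt_iii))
        \<and> (stmt_i \<longrightarrow> stmt_ii) \<and> (stmt_ii \<longrightarrow> stmt_iii)"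
proof -
  \<comment> \<open>Surjectivity of the growth rate supplies a point of \<open>J\<close>, at which
    an initial value can be prescribed.\<close>
  have "h ` J = {0<..}" using assms(4) by (auto simp: growth_rate_def homeomorphism_def)
  then have "1 \<in> h ` J" by simp
  then have "J \<noteq> {}" by blast
  have J: "J = einterval a0 \<infinity>" using assms(3) by (simp add: einterval_def)
  obtain F where F: "fundamental_matrix J A F" "transition_matrix J A = (\<lambda>t s. F t ** matrix_inv (F s))"
      "continuous_on J F" "\<And>x. is_solution J A x \<longleftrightarrow> (\<exists>v. \<forall>t\<in>J. x t = F t *v v)"
    using solution_structure[OF J \<open>J \<noteq> {}\<close> assms(5)] by metis
  have up: "u \<in> J" if "t \<in> J" "t \<le> u" for t u
    using that less_le_trans[of a0 "ereal t" "ereal u"] by (simp add: assms(3))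
  interpret reparametrized_system J h N A F
    by unfold_locales (fact assms(4), fact up, fact assms(1), fact F(1), fact F(2), fact F(3), fact F(4))
  let ?bdd = "has_nontrivial_bounded_solution N J A"
  have pos: "uniform_dichotomy N J h A {gunit J h..} \<longleftrightarrow> exp_dichotomy N y {0..}"
    and neg: "uniform_dichotomy N J h A (J \<inter> {..gunit J h}) \<longleftrightarrow> exp_dichotomy N y {..0}"
    unfolding image_half_lines by (simp_all add: dichotomy_iff)
  have i_ii: "exp_expansive N y"
    if "exp_dichotomy N y {0..}" "exp_dichotomy N y {..0}" "\<not> ?bdd"
    using that(3) unfolding nontrivial_bounded_iff
    by (intro exp_dichotomies_imp_expansive[OF N lin inj_y that(1,2)]) blast
  have ii_iii: "noncritical N y" if "exp_expansive N y"
    by (rule exp_expansive_imp_noncritical[OF N that])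
  have iii_i: "exp_dichotomy N y {0..} \<and> exp_dichotomy N y {..0} \<and> \<not> ?bdd"
    if nc: "noncritical N y"
      and growth: "uniform_bounded_growth N J h A {gunit J h..}"
      and decay: "uniform_bounded_decay N J h A (J \<inter> {..gunit J h})"
  proof (intro conjI)
    show "exp_dichotomy N y {0..}"
      by (rule half_line_exp_dichotomy[OF N lin cont nc bounded_growth_y[OF growth]])
    have "noncritical N (\<lambda>t. y (- t))" by (rule noncritical_reflect[OF nc])
    moreover have "continuous_on {0..} (\<lambda>t. y (- t) v)" for v
      by (rule continuous_on_compose2[OF cont[of UNIV]]) (auto intro: continuous_intros)
    ultimately have "exp_dichotomy N (\<lambda>t. y (- t)) {0..}"
      by (intro half_line_exp_dichotomy[OF N lin _ _ bounded_decay_y[OF decay]])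
    then show "exp_dichotomy N y {..0}" by (rule exp_dichotomy_reflect)
    show "\<not> ?bdd"
      unfolding nontrivial_bounded_iff
    proof safe
      fix v B assume "v \<noteq> 0" and "\<forall>\<tau>. N (y \<tau> v) \<le> B"
      then have "N (y 0 v) = 0" by (intro noncritical_bounded_eq_0[OF N nc]) blast
      then have "v = 0" using linear_injective_0[OF lin[of 0]] inj_y by (simp add: is_norm_eq_0[OF N])
      with \<open>v \<noteq> 0\<close> show False ..
    qed
  qed
  show ?thesis
    unfolding Let_def pos neg expansive_iff noncritical_iff using i_ii ii_iii iii_i by blast
qed

end
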